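(* Let $n\in\mathbb N\cup\{\infty\}$. The category $n\mathsf{Whit}$ of Whitney $n$-categories is cocomplete.
   Context: Stratified spaces. A stratification of a smooth manifold $M$ is a decomposition $M=\bigcup_{i\in\mathcal S}S_i$ into disjoint subsets (strata) indexed by a poset $\mathcal S$ such that: (1) it is locally finite; (2) $S_i\cap\overline{S_j}\neq\emptyset$ iff $S_i\subset\overline{S_j}$, and this occurs precisely when $i\le j$; (3) each $S_i$ is a locally closed smooth connected submanifold. A Whitney stratified manifold is a manifold with a stratification satisfying Whitney condition B: if $x\in S_i\subset\overline{S_j}$, sequences $(x_k)$ in $S_i$ and $(y_k)$ in $S_j$ converge to $x$, the secant lines $\overline{x_ky_k}$ converge to a line $L\le T_xM$ and the tangent planes $T_{y_k}S_j$ converge to $P\le T_xM$, then $L\le P$. A Whitney stratified space is a closed union of strata in a Whitney stratified manifold. In what follows "stratified space" means the stable germ of a compact Whitney stratified subspace of some $\mathbb R^k$ (stabilising by the standard inclusions $\mathbb R^k\hookrightarrow\mathbb R^{k+1}\hookrightarrow\cdots$); the same letter denotes the germ and the underlying space. A smooth map of such is the stable germ (stabilising by products with $\mathbb R$) of a map which extends to a smooth map of the ambient spaces. A stratified space is cellular if every stratum is contractible. Maps. A smooth map $f\colon X\to Y$ is stratified if for every stratum $B$ of $Y$ the preimage $f^{-1}B$ is a union of strata of $X$ and for every stratum $A\subset f^{-1}B$ the restriction $f|_A\colon A\to B$ is a submersion. A subdivision of $X$ is a Whitney stratification of the underlying space of $X$, each of whose strata lies in a stratum of $X$, with the same stable germ.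 A smooth map is prestratified if it becomes stratified for some subdivision of its source. Two (pre)stratified maps $f,g\colon X\to Y$ are homotopic relative to strata of dimension $<n$ if there is a smooth map germ $h\colon X\times[0,1]\to Y$ from $f$ to $g$ with each $h(-,t)$ (pre)stratified and $h(x,t)=h(x,0)$ for all $t$ whenever $x$ lies in a stratum of dimension $<n$. Categories. For $n\in\mathbb N\cup\{\infty\}$, $\mathsf{Strat}_n$ (respectively $\mathsf{Prestrat}_n$) is the small category whose objects are compact cellular stratified spaces of dimension $\le n$ and whose morphisms are homotopy classes of stratified (respectively prestratified) maps relative to strata of dimension $<n$ (for $n=\infty$, simply the maps). A stratified map $f\colon Y\to X$ trivially covers a stratum $A\subset X$ if $f^{-1}A$ is a single stratum and $f|_{f^{-1}A}$ is a diffeomorphism onto $A$. $\mathsf{Strat}_n$ has the Grothendieck topology in which a sieve on $X$ is covering iff for each stratum of $X$ there is a map in the sieve trivially covering it. Whitney categories. A Whitney $n$-category is a presheaf of sets on $\mathsf{Prestrat}_n$ whose restriction to $\mathsf{Strat}_n$ is a sheaf. A functor of Whitney $n$-categories is a natural transformation of presheaves. $n\mathsf{Whit}$ is the resulting full subcategory of the category of presheaves on $\mathsf{Prestrat}_n$. *)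

theory Defs
  imports "HOL-Analysis.Analysis" "HOL-Library.Extended_Nat" "HOL-Library.Equipollence"
begin

section \<open>Smooth maps and submanifolds of $R^k$, for varying $k$\<close>

text \<open>All the spaces $R^k$ are regarded as subspaces of one type of real sequences, so that the
  standard inclusion of $R^k$ into $R^{k+1}$ is set inclusion. The library topology on this function
  type is the product topology. It induces the Euclidean topology on each \<open>Rk k\<close>, which is a closed
  subset, so the library's closures, limits, compactness and connectedness have their usual
  meaning.\<close>

type_synonym rvec = "nat \<Rightarrow> real"

definition Rk :: "nat \<Rightarrow> rvec set" where
  "Rk k = {x. \<forall>i\<ge>k. x i = 0}"

definition partial :: "nat \<Rightarrow> (rvec \<Rightarrow> real) \<Rightarrow> rvec \<Rightarrow> real" where
  "partial i f x = deriv (\<lambda>t. f (x(i := t))) (x i)"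

text \<open>\<open>C_diff k m U f\<close>: all partial derivatives of \<open>f\<close> of order at most \<open>m\<close> in the first \<open>k\<close> coordinates
  exist and are continuous on \<open>U\<close>. It is used for relatively open subsets \<open>U\<close> of \<open>Rk k\<close> only.\<close>

fun C_diff :: "nat \<Rightarrow> nat \<Rightarrow> rvec set \<Rightarrow> (rvec \<Rightarrow> real) \<Rightarrow> bool" where
  "C_diff k 0 U f \<longleftrightarrow> continuous_on U f"
| "C_diff k (Suc m) U f \<longleftrightarrow> continuous_on U f \<and>
     (\<forall>i<k. (\<forall>x\<in>U. (\<lambda>t. f (x(i := t))) differentiable at (x i)) \<and> C_diff k m U (partial i f))"

definition smooth_map :: "nat \<Rightarrow> nat \<Rightarrow> rvec set \<Rightarrow> (rvec \<Rightarrow> rvec) \<Rightarrow> bool" where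
  "smooth_map k l U F \<longleftrightarrow> F ` U \<subseteq> Rk l \<and> (\<forall>j<l. \<forall>m. C_diff k m U (\<lambda>x. F x j))"

definition open_in_Rk :: "nat \<Rightarrow> rvec set \<Rightarrow> bool" where
  "open_in_Rk k U \<longleftrightarrow> openin (top_of_set (Rk k)) U"

definition submanifold :: "nat \<Rightarrow> nat \<Rightarrow> rvec set \<Rightarrow> bool" where
  "submanifold k d S \<longleftrightarrow> d \<le> k \<and> S \<subseteq> Rk k \<and>
     (\<forall>p\<in>S. \<exists>U V \<phi> \<psi>. p \<in> U \<and> open_in_Rk k U \<and> open_in_Rk k V \<and>
        smooth_map k k U \<phi> \<and> smooth_map k k V \<psi> \<and> \<phi> ` U = V \<and> \<psi> ` V = U \<and>
        (\<forall>x\<in>U. \<psi> (\<phi> x) = x) \<and> (\<forall>y\<in>V. \<phi> (\<psi> y) = y) \<and> \<phi> ` (U \<inter> S) = V \<inter> Rk d)"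

definition has_dim :: "rvec set \<Rightarrow> nat \<Rightarrow> bool" where
  "has_dim S d \<longleftrightarrow> (\<exists>k. submanifold k d S)"

definition smooth_curve_in :: "rvec set \<Rightarrow> rvec \<Rightarrow> (real \<Rightarrow> rvec) \<Rightarrow> bool" where
  "smooth_curve_in S p \<gamma> \<longleftrightarrow> \<gamma> 0 = p \<and> (\<forall>t. \<gamma> t \<in> S) \<and>
     (\<forall>i m t. (deriv ^^ m) (\<lambda>s. \<gamma> s i) differentiable at t)"

definition velocity :: "(real \<Rightarrow> rvec) \<Rightarrow> rvec \<Rightarrow> bool" where
  "velocity \<gamma> v \<longleftrightarrow> (\<forall>i. ((\<lambda>t. \<gamma> t i) has_real_derivative v i) (at 0))"

definition tangent_space :: "rvec set \<Rightarrow> rvec \<Rightarrow> rvec set" where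
  "tangent_space S p = {v. \<exists>\<gamma>. smooth_curve_in S p \<gamma> \<and> velocity \<gamma> v}"

text \<open>\<open>tangent_map f A a v w\<close>: the derivative at \<open>a\<close> of the restriction of \<open>f\<close> to \<open>A\<close> maps the tangent vector
  \<open>v\<close> to \<open>w\<close>, tangent vectors being represented by curves.\<close>

definition tangent_map :: "(rvec \<Rightarrow> rvec) \<Rightarrow> rvec set \<Rightarrow> rvec \<Rightarrow> rvec \<Rightarrow> rvec \<Rightarrow> bool" where
  "tangent_map f A a v w \<longleftrightarrow>
     (\<exists>\<gamma>. smooth_curve_in A a \<gamma> \<and> velocity \<gamma> v \<and> velocity (f \<circ> \<gamma>) w)"

definition submersion :: "rvec set \<Rightarrow> rvec set \<Rightarrow> (rvec \<Rightarrow> rvec) \<Rightarrow> bool" where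
  "submersion A B f \<longleftrightarrow> f ` A \<subseteq> B \<and>
     (\<forall>a\<in>A. \<forall>w\<in>tangent_space B (f a). \<exists>v\<in>tangent_space A a. tangent_map f A a v w)"

definition smooth_on_submanifold :: "rvec set \<Rightarrow> (rvec \<Rightarrow> rvec) \<Rightarrow> bool" where
  "smooth_on_submanifold A f \<longleftrightarrow>
     (\<forall>a\<in>A. \<exists>k l U F. A \<subseteq> Rk k \<and> a \<in> U \<and> open_in_Rk k U \<and> smooth_map k l U F \<and>
        (\<forall>x\<in>A \<inter> U. F x = f x))"

definition diffeomorphism_between :: "rvec set \<Rightarrow> rvec set \<Rightarrow> (rvec \<Rightarrow> rvec) \<Rightarrow> bool" where
  "diffeomorphism_between A B f \<longleftrightarrow> bij_betw f A B \<and>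
     smooth_on_submanifold A f \<and> smooth_on_submanifold B (inv_into A f)"


section \<open>Whitney stratified spaces\<close>

text \<open>Convergence of \<open>d\<close>-dimensional linear subspaces in the Grassmannian: there are
  bases of the subspaces converging to a basis of the limit.\<close>

definition is_basis :: "nat \<Rightarrow> (nat \<Rightarrow> rvec) \<Rightarrow> rvec set \<Rightarrow> bool" where
  "is_basis d b V \<longleftrightarrow>
     V = {(\<lambda>j. \<Sum>i<d. c i * b i j) | c. True} \<and>
     (\<forall>c. (\<forall>j. (\<Sum>i<d. c i * b i j) = 0) \<longrightarrow> (\<forall>i<d. c i = 0))"

definition subspaces_converge :: "nat \<Rightarrow> (nat \<Rightarrow> rvec set) \<Rightarrow> rvec set \<Rightarrow> bool" where
  "subspaces_converge d V W \<longleftrightarrow>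
     (\<exists>b b'. (\<forall>m. is_basis d (b m) (V m)) \<and> is_basis d b' W \<and>
        (\<forall>i<d. (\<lambda>m. b m i) \<longlonglongrightarrow> b' i))"

definition secant :: "rvec \<Rightarrow> rvec \<Rightarrow> rvec set" where
  "secant x y = {(\<lambda>j. t * (y j - x j)) | t. True}"

definition whitney_B :: "rvec set \<Rightarrow> rvec set \<Rightarrow> bool" where
  "whitney_B S T \<longleftrightarrow>
     (\<forall>x\<in>S. \<forall>xs ys L P d.
        (\<forall>m. xs m \<in> S \<and> ys m \<in> T \<and> xs m \<noteq> ys m) \<and> xs \<longlonglongrightarrow> x \<and> ys \<longlonglongrightarrow> x \<and>
        subspaces_converge 1 (\<lambda>m. secant (xs m) (ys m)) L \<and>
        subspaces_converge d (\<lambda>m. tangent_space T (ys m)) P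
        \<longrightarrow> L \<subseteq> P)"

text \<open>A stratification is given by its set of strata; the indexing poset is the set of strata itself,
  ordered by inclusion of a stratum in the closure of another. The frontier condition, read as an
  equivalence also for a stratum and itself, forces strata to be nonempty, so that an indexed
  decomposition and its set of strata carry the same information.\<close>

definition stratification :: "nat \<Rightarrow> rvec set set \<Rightarrow> bool" where
  "stratification k \<S> \<longleftrightarrow>
     \<Union>\<S> = Rk k \<and> disjoint \<S> \<and>
     (\<forall>x\<in>Rk k. \<exists>U. open_in_Rk k U \<and> x \<in> U \<and> finite {S\<in>\<S>. S \<inter> U \<noteq> {}}) \<and>
     (\<forall>S\<in>\<S>. \<forall>T\<in>\<S>. S \<inter> closure T \<noteq> {} \<longleftrightarrow> S \<subseteq> closure T) \<and>
     (\<forall>S\<in>\<S>. \<forall>T\<in>\<S>. S \<subseteq> closure T \<and> T \<subseteq> closure S \<longrightarrow> S = T) \<and>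
     (\<forall>S\<in>\<S>. (\<exists>U C. open U \<and> closed C \<and> S = U \<inter> C) \<and> connected S \<and> (\<exists>d. submanifold k d S))"

definition whitney_stratification :: "nat \<Rightarrow> rvec set set \<Rightarrow> bool" where
  "whitney_stratification k \<S> \<longleftrightarrow> stratification k \<S> \<and>
     (\<forall>S\<in>\<S>. \<forall>T\<in>\<S>. S \<subseteq> closure T \<longrightarrow> whitney_B S T)"

text \<open>A stratified space is represented by its set of strata, its underlying space being their union.
  Since \<open>Rk k\<close> is contained in \<open>Rk (Suc k)\<close>, compact stratified subspaces of Euclidean spaces that agree
  after stabilisation are equal here, and the remaining strata of the ambient Euclidean space are not
  part of the data.\<close>

type_synonym strat = "rvec set set"

definition stratified_space :: "strat \<Rightarrow> bool" where
  "stratified_space X \<longleftrightarrow>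
     (\<exists>k \<S>. whitney_stratification k \<S> \<and> X \<subseteq> \<S>) \<and> compact (\<Union>X)"

definition cellular :: "strat \<Rightarrow> bool" where
  "cellular X \<longleftrightarrow> (\<forall>A\<in>X. contractible A)"

definition subdivision :: "strat \<Rightarrow> strat \<Rightarrow> bool" where
  "subdivision X' X \<longleftrightarrow> stratified_space X' \<and> \<Union>X' = \<Union>X \<and> (\<forall>A'\<in>X'. \<exists>A\<in>X. A' \<subseteq> A)"


section \<open>Stratified and prestratified maps\<close>

text \<open>Maps are functions on the underlying space of the source, with the value \<open>undefined\<close> elsewhere.\<close>

type_synonym smap = "rvec \<Rightarrow> rvec"

definition smooth :: "strat \<Rightarrow> strat \<Rightarrow> smap \<Rightarrow> bool" where
  "smooth X Y f \<longleftrightarrow> f \<in> \<Union>X \<rightarrow>\<^sub>E \<Union>Y \<and>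
     (\<exists>k l F. \<Union>X \<subseteq> Rk k \<and> \<Union>Y \<subseteq> Rk l \<and> smooth_map k l (Rk k) F \<and> (\<forall>x\<in>\<Union>X. F x = f x))"

definition preim :: "strat \<Rightarrow> smap \<Rightarrow> rvec set \<Rightarrow> rvec set" where
  "preim X f B = {x\<in>\<Union>X. f x \<in> B}"

definition stratified :: "strat \<Rightarrow> strat \<Rightarrow> smap \<Rightarrow> bool" where
  "stratified X Y f \<longleftrightarrow> smooth X Y f \<and>
     (\<forall>B\<in>Y. (\<exists>\<A>\<subseteq>X. preim X f B = \<Union>\<A>) \<and>
        (\<forall>A\<in>X. A \<subseteq> preim X f B \<longrightarrow> submersion A B f))"

definition prestratified :: "strat \<Rightarrow> strat \<Rightarrow> smap \<Rightarrow> bool" where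
  "prestratified X Y f \<longleftrightarrow> (\<exists>X'. subdivision X' X \<and> stratified X' Y f)"

text \<open>In the following the parameter \<open>K\<close> is the class of maps, \<open>stratified\<close> or \<open>prestratified\<close>.
  The product of a subset of \<open>Rk k\<close> with the unit interval is placed in \<open>Rk (Suc k)\<close>, the point \<open>(x, t)\<close>
  being \<open>x(k := t)\<close>.\<close>

definition homotopic_rel ::
    "enat \<Rightarrow> (strat \<Rightarrow> strat \<Rightarrow> smap \<Rightarrow> bool) \<Rightarrow> strat \<Rightarrow> strat \<Rightarrow> smap \<Rightarrow> smap \<Rightarrow> bool" where
  "homotopic_rel n K X Y f g \<longleftrightarrow>
     (\<exists>h :: real \<Rightarrow> smap. h 0 = f \<and> h 1 = g \<and> (\<forall>t\<in>{0..1}. K X Y (h t)) \<and>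
        (\<exists>k l H. \<Union>X \<subseteq> Rk k \<and> \<Union>Y \<subseteq> Rk l \<and> smooth_map (Suc k) l (Rk (Suc k)) H \<and>
           (\<forall>x\<in>\<Union>X. \<forall>t\<in>{0..1}. H (x(k := t)) = h t x)) \<and>
        (\<forall>A\<in>X. \<forall>d. has_dim A d \<and> enat d < n \<longrightarrow>
           (\<forall>x\<in>A. \<forall>t\<in>{0..1}. h t x = h 0 x)))"

text \<open>The equivalence relation generated by \<open>homotopic_rel\<close>. For \<open>n = \<infinity>\<close> homotopies are
  constant, and the relation is equality.\<close>

definition homotopy ::
    "enat \<Rightarrow> (strat \<Rightarrow> strat \<Rightarrow> smap \<Rightarrow> bool) \<Rightarrow> strat \<Rightarrow> strat \<Rightarrow> (smap \<times> smap) set" where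
  "homotopy n K X Y =
     ({(f, g). homotopic_rel n K X Y f g} \<union> {(f, g). homotopic_rel n K X Y g f})\<^sup>*"


section \<open>Categories, functors and colimits\<close>

text \<open>Composition takes the three objects involved as arguments, so hom-sets need not be disjoint.
  \<open>cmp C X Y Z G F\<close> is the composite of \<open>F\<close> from \<open>X\<close> to \<open>Y\<close> and \<open>G\<close> from \<open>Y\<close> to \<open>Z\<close>.\<close>

record ('o, 'm) cat =
  obj :: "'o set"
  hom :: "'o \<Rightarrow> 'o \<Rightarrow> 'm set"
  idn :: "'o \<Rightarrow> 'm"
  cmp :: "'o \<Rightarrow> 'o \<Rightarrow> 'o \<Rightarrow> 'm \<Rightarrow> 'm \<Rightarrow> 'm"

definition is_category :: "('o, 'm) cat \<Rightarrow> bool" where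
  "is_category C \<longleftrightarrow>
     (\<forall>X\<in>obj C. idn C X \<in> hom C X X) \<and>
     (\<forall>X\<in>obj C. \<forall>Y\<in>obj C. \<forall>Z\<in>obj C. \<forall>f\<in>hom C X Y. \<forall>g\<in>hom C Y Z.
        cmp C X Y Z g f \<in> hom C X Z) \<and>
     (\<forall>X\<in>obj C. \<forall>Y\<in>obj C. \<forall>f\<in>hom C X Y.
        cmp C X X Y f (idn C X) = f \<and> cmp C X Y Y (idn C Y) f = f) \<and>
     (\<forall>W\<in>obj C. \<forall>X\<in>obj C. \<forall>Y\<in>obj C. \<forall>Z\<in>obj C.
        \<forall>f\<in>hom C W X. \<forall>g\<in>hom C X Y. \<forall>h\<in>hom C Y Z.
        cmp C W X Z (cmp C X Y Z h g) f = cmp C W Y Z h (cmp C W X Y g f))"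

definition is_functor ::
    "('j, 'a) cat \<Rightarrow> ('o, 'm) cat \<Rightarrow> ('j \<Rightarrow> 'o) \<Rightarrow> ('j \<Rightarrow> 'j \<Rightarrow> 'a \<Rightarrow> 'm) \<Rightarrow> bool" where
  "is_functor J C D DD \<longleftrightarrow>
     (\<forall>i\<in>obj J. D i \<in> obj C) \<and>
     (\<forall>i\<in>obj J. \<forall>j\<in>obj J. \<forall>a\<in>hom J i j. DD i j a \<in> hom C (D i) (D j)) \<and>
     (\<forall>i\<in>obj J. DD i i (idn J i) = idn C (D i)) \<and>
     (\<forall>i\<in>obj J. \<forall>j\<in>obj J. \<forall>k\<in>obj J. \<forall>a\<in>hom J i j. \<forall>b\<in>hom J j k.
        DD i k (cmp J i j k b a) = cmp C (D i) (D j) (D k) (DD j k b) (DD i j a))"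

definition is_cocone ::
    "('j, 'a) cat \<Rightarrow> ('o, 'm) cat \<Rightarrow> ('j \<Rightarrow> 'o) \<Rightarrow> ('j \<Rightarrow> 'j \<Rightarrow> 'a \<Rightarrow> 'm) \<Rightarrow> 'o \<Rightarrow> ('j \<Rightarrow> 'm) \<Rightarrow> bool"
  where
  "is_cocone J C D DD L lam \<longleftrightarrow> L \<in> obj C \<and>
     (\<forall>i\<in>obj J. lam i \<in> hom C (D i) L) \<and>
     (\<forall>i\<in>obj J. \<forall>j\<in>obj J. \<forall>a\<in>hom J i j. cmp C (D i) (D j) L (lam j) (DD i j a) = lam i)"

definition is_colimit ::
    "('j, 'a) cat \<Rightarrow> ('o, 'm) cat \<Rightarrow> ('j \<Rightarrow> 'o) \<Rightarrow> ('j \<Rightarrow> 'j \<Rightarrow> 'a \<Rightarrow> 'm) \<Rightarrow> 'o \<Rightarrow> ('j \<Rightarrow> 'm) \<Rightarrow> bool"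
  where
  "is_colimit J C D DD L lam \<longleftrightarrow> is_cocone J C D DD L lam \<and>
     (\<forall>M mu. is_cocone J C D DD M mu \<longrightarrow>
        (\<exists>!u. u \<in> hom C L M \<and> (\<forall>i\<in>obj J. cmp C (D i) L M u (lam i) = mu i)))"

text \<open>Set theory. The small sets are the members of a family \<open>U\<close> of subsets of a type. Instead of closure
  under all power sets, only closure under powers with exponent \<open>I\<close> is required, where \<open>I\<close> is meant to be
  at least as large as the sites over which presheaves are considered. Thus every Grothendieck universe
  containing \<open>I\<close> qualifies (\<open>set_universe_grothendieck\<close>), but so does the family of all subsets of a
  suitable type, which may be chosen larger than any given type (\<open>set_universe_UNIV\<close>).\<close>

definition set_universe :: "'i set \<Rightarrow> 'u set set \<Rightarrow> bool" where
  "set_universe I U \<longleftrightarrow>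
     (\<exists>A\<in>U. infinite A) \<and>
     (\<forall>A\<in>U. \<forall>B\<subseteq>A. B \<in> U) \<and>
     (\<forall>A\<in>U. \<forall>f. f ` A \<in> U) \<and>
     (\<forall>J\<in>U. \<forall>A. (\<forall>j\<in>J. A j \<in> U) \<longrightarrow> (\<Union>j\<in>J. A j) \<in> U) \<and>
     (\<forall>A\<in>U. \<exists>B\<in>U. (I \<rightarrow>\<^sub>E A) \<lesssim> B)"

lemma set_universe_UNIV:
  "set_universe (I :: 'i set) (UNIV :: (nat \<times> 'i list \<times> 'a) set set set)"
proof -
  define c :: "('i \<Rightarrow> (nat \<times> 'i list \<times> 'a) set) \<Rightarrow> (nat \<times> 'i list \<times> 'a) set" where
    "c f = {(m, l, a). l \<noteq> [] \<and> hd l \<in> I \<and> (m, tl l, a) \<in> f (hd l)}" for f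
  have c: "(m, l, a) \<in> f i \<longleftrightarrow> (m, i # l, a) \<in> c f" if "i \<in> I" for f i m l a
    using that by (simp add: c_def)
  have eq: "f i = g i" if "c f = c g" "i \<in> I" for f g i
    using c[OF that(2), of _ _ _ f] c[OF that(2), of _ _ _ g] that(1) by auto
  have "inj_on c (I \<rightarrow>\<^sub>E A)" for A
  proof (rule inj_onI)
    fix f g assume f: "f \<in> I \<rightarrow>\<^sub>E A" and g: "g \<in> I \<rightarrow>\<^sub>E A" and fg: "c f = c g"
    show "f = g" by (rule PiE_ext[OF f g]) (rule eq[OF fg])
  qed
  then have "(I \<rightarrow>\<^sub>E A) \<lesssim> (UNIV :: (nat \<times> 'i list \<times> 'a) set set)"
    for A :: "(nat \<times> 'i list \<times> 'a) set set"
    unfolding lepoll_def by (intro exI[of _ c]) simp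
  moreover have "infinite (UNIV :: (nat \<times> 'i list \<times> 'a) set set)"
    by (simp add: Finite_Set.finite_set finite_prod)
  ultimately show ?thesis
    unfolding set_universe_def by auto
qed

lemma set_universe_grothendieck:
  fixes U :: "'u set set"
  assumes inf: "\<exists>A\<in>U. infinite A"
    and sub: "\<And>A B. A \<in> U \<Longrightarrow> B \<subseteq> A \<Longrightarrow> B \<in> U"
    and img: "\<And>A f. A \<in> U \<Longrightarrow> f ` A \<in> U"
    and un: "\<And>J A. J \<in> U \<Longrightarrow> (\<And>j. j \<in> J \<Longrightarrow> A j \<in> U) \<Longrightarrow> (\<Union>j\<in>J. A j) \<in> U"
    and pow: "\<And>A. A \<in> U \<Longrightarrow> \<exists>B\<in>U. Pow A \<lesssim> B"
    and I: "\<exists>C\<in>U. I \<lesssim> C"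
  shows "set_universe I U"
proof -
  obtain N where N: "N \<in> U" "infinite N" using inf by blast
  obtain C where C: "C \<in> U" "I \<lesssim> C" using I by blast
  obtain p where p: "p \<in> N" using N(2) by fastforce
  have "infinite (N - {p})" using N(2) by simp
  then obtain q where "q \<in> N - {p}" by (metis finite.emptyI ex_in_conv)
  with p have pq: "p \<in> N" "q \<in> N" "p \<noteq> q" by auto
  have Un: "A \<union> B \<in> U" if "A \<in> U" "B \<in> U" for A B
  proof -
    have "(\<Union>j\<in>{p, q}. if j = p then A else B) \<in> U"
      using that pq by (intro un) (auto intro: sub[OF N(1)])
    then show ?thesis using pq by (auto simp: Un_commute)
  qed
  have "\<exists>B\<in>U. (I \<rightarrow>\<^sub>E A) \<lesssim> B" if A: "A \<in> U" for A
  proof -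
    define M where "M = N \<union> C \<union> A"
    have M: "M \<in> U" "infinite M" using Un A N C by (auto simp: M_def)
    obtain e where e: "inj_on e I" "e ` I \<subseteq> C" using C by (auto simp: lepoll_def)
    obtain b where b: "bij_betw b (M \<times> M) M"
      using card_of_Times_same_infinite[OF M(2)] by (auto simp: card_of_ordIso[symmetric])
    let ?g = "\<lambda>f. (\<lambda>i. b (e i, f i)) ` I"
    have eM: "e i \<in> M" if "i \<in> I" for i using e that by (auto simp: M_def)
    have bi: "inj_on b (M \<times> M)" and bs: "b ` (M \<times> M) = M" using b by (auto simp: bij_betw_def)
    have "inj_on ?g (I \<rightarrow>\<^sub>E A)"
    proof (rule inj_onI)
      fix f g assume f: "f \<in> I \<rightarrow>\<^sub>E A" and g: "g \<in> I \<rightarrow>\<^sub>E A" and eq: "?g f = ?g g"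
      show "f = g"
      proof (rule PiE_ext[OF f g])
        fix i assume i: "i \<in> I"
        then have "b (e i, f i) \<in> ?g g" using eq by blast
        then obtain i' where i': "i' \<in> I" "b (e i, f i) = b (e i', g i')" by blast
        have "f i \<in> M" "g i' \<in> M" using f g i i' by (auto simp: M_def)
        then have "(e i, f i) = (e i', g i')"
          using inj_onD[OF bi i'(2)] eM i i'(1) by auto
        then show "f i = g i" using e(1) i i'(1) by (auto dest: inj_onD)
      qed
    qed
    moreover have "?g ` (I \<rightarrow>\<^sub>E A) \<subseteq> Pow M"
    proof -
      have "b (e i, f i) \<in> M" if "f \<in> I \<rightarrow>\<^sub>E A" "i \<in> I" for f i
      proof -
        have "f i \<in> M" using that by (auto simp: M_def)
        then show ?thesis using bs eM that(2) by blast
      qed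
      then show ?thesis by blast
    qed
    ultimately have "(I \<rightarrow>\<^sub>E A) \<lesssim> Pow M" by (auto simp: lepoll_def)
    then show ?thesis using pow[OF M(1)] lepoll_trans by blast
  qed
  then show ?thesis
    unfolding set_universe_def using inf sub img by (intro conjI ballI allI impI un) simp_all
qed

definition small_category :: "'u set set \<Rightarrow> ('u, 'u) cat \<Rightarrow> bool" where
  "small_category U J \<longleftrightarrow> is_category J \<and> obj J \<in> U \<and> (\<forall>i\<in>obj J. \<forall>j\<in>obj J. hom J i j \<in> U)"

definition cocomplete :: "'u set set \<Rightarrow> ('o, 'm) cat \<Rightarrow> bool" where
  "cocomplete U C \<longleftrightarrow>
     (\<forall>J D DD. small_category U J \<and> is_functor J C D DD \<longrightarrow> (\<exists>L lam. is_colimit J C D DD L lam))"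


section \<open>Presheaves of small sets\<close>

record ('o, 'm, 'u) psh =
  ob :: "'o \<Rightarrow> 'u set"
  mp :: "'o \<Rightarrow> 'o \<Rightarrow> 'm \<Rightarrow> 'u \<Rightarrow> 'u"

definition is_presheaf :: "'u set set \<Rightarrow> ('o, 'm) cat \<Rightarrow> ('o, 'm, 'u) psh \<Rightarrow> bool" where
  "is_presheaf U C P \<longleftrightarrow>
     (\<forall>X\<in>obj C. ob P X \<in> U) \<and>
     (\<forall>X\<in>obj C. \<forall>Y\<in>obj C. \<forall>F\<in>hom C X Y. mp P X Y F \<in> ob P Y \<rightarrow> ob P X) \<and>
     (\<forall>X\<in>obj C. \<forall>x\<in>ob P X. mp P X X (idn C X) x = x) \<and>
     (\<forall>X\<in>obj C. \<forall>Y\<in>obj C. \<forall>Z\<in>obj C. \<forall>F\<in>hom C X Y. \<forall>G\<in>hom C Y Z. \<forall>x\<in>ob P Z.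
        mp P X Z (cmp C X Y Z G F) x = mp P X Y F (mp P Y Z G x))"

definition nat_trans ::
    "('o, 'm) cat \<Rightarrow> ('o, 'm, 'u) psh \<Rightarrow> ('o, 'm, 'u) psh \<Rightarrow> ('o \<Rightarrow> 'u \<Rightarrow> 'u) set" where
  "nat_trans C P Q =
     {\<eta> \<in> (\<Pi>\<^sub>E X\<in>obj C. ob P X \<rightarrow>\<^sub>E ob Q X).
        \<forall>X\<in>obj C. \<forall>Y\<in>obj C. \<forall>F\<in>hom C X Y. \<forall>y\<in>ob P Y.
          \<eta> X (mp P X Y F y) = mp Q X Y F (\<eta> Y y)}"

definition presheaf_category ::
    "'u set set \<Rightarrow> ('o, 'm) cat \<Rightarrow> (('o, 'm, 'u) psh, 'o \<Rightarrow> 'u \<Rightarrow> 'u) cat" where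
  "presheaf_category U C =
     \<lparr> obj = {P. is_presheaf U C P},
       hom = nat_trans C,
       idn = (\<lambda>P. \<lambda>X\<in>obj C. \<lambda>x\<in>ob P X. x),
       cmp = (\<lambda>P Q R \<theta> \<eta>. \<lambda>X\<in>obj C. \<lambda>x\<in>ob P X. \<theta> X (\<eta> X x)) \<rparr>"

definition full_subcategory :: "('o, 'm) cat \<Rightarrow> ('o \<Rightarrow> bool) \<Rightarrow> ('o, 'm) cat" where
  "full_subcategory C \<Phi> = C \<lparr> obj := {X\<in>obj C. \<Phi> X} \<rparr>"


section \<open>Whitney categories\<close>

definition cell_space :: "enat \<Rightarrow> strat \<Rightarrow> bool" where
  "cell_space n X \<longleftrightarrow> stratified_space X \<and> cellular X \<and> (\<forall>A\<in>X. \<exists>d. has_dim A d \<and> enat d \<le> n)"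

text \<open>Morphisms are homotopy classes, and classes are composed by composing representatives.\<close>

definition map_category ::
    "enat \<Rightarrow> (strat \<Rightarrow> strat \<Rightarrow> smap \<Rightarrow> bool) \<Rightarrow> (strat, smap set) cat" where
  "map_category n K =
     \<lparr> obj = {X. cell_space n X},
       hom = (\<lambda>X Y. {f. K X Y f} // homotopy n K X Y),
       idn = (\<lambda>X. homotopy n K X X `` {\<lambda>x\<in>\<Union>X. x}),
       cmp = (\<lambda>X Y Z G F. homotopy n K X Z `` {compose (\<Union>X) g f | g f. g \<in> G \<and> f \<in> F}) \<rparr>"

definition Strat :: "enat \<Rightarrow> (strat, smap set) cat" where
  "Strat n = map_category n stratified"

definition Prestrat :: "enat \<Rightarrow> (strat, smap set) cat" where
  "Prestrat n = map_category n prestratified"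

definition trivially_covers :: "strat \<Rightarrow> strat \<Rightarrow> smap \<Rightarrow> rvec set \<Rightarrow> bool" where
  "trivially_covers Y X f A \<longleftrightarrow>
     preim Y f A \<in> Y \<and> diffeomorphism_between (preim Y f A) A f"

text \<open>A sieve on \<open>X\<close> is given by the pairs \<open>(W, F)\<close> of its members \<open>F\<close> and their sources \<open>W\<close>.\<close>

definition is_sieve :: "('o, 'm) cat \<Rightarrow> 'o \<Rightarrow> ('o \<times> 'm) set \<Rightarrow> bool" where
  "is_sieve C X R \<longleftrightarrow>
     (\<forall>(W, F)\<in>R. W \<in> obj C \<and> F \<in> hom C W X) \<and>
     (\<forall>(W, F)\<in>R. \<forall>V\<in>obj C. \<forall>G\<in>hom C V W. (V, cmp C V W X F G) \<in> R)"

definition covering_sieve :: "enat \<Rightarrow> strat \<Rightarrow> (strat \<times> smap set) set \<Rightarrow> bool" where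
  "covering_sieve n X R \<longleftrightarrow> is_sieve (Strat n) X R \<and>
     (\<forall>A\<in>X. \<exists>(W, F)\<in>R. \<exists>f\<in>F. trivially_covers W X f A)"

definition is_sheaf ::
    "('o, 'm) cat \<Rightarrow> ('o \<Rightarrow> ('o \<times> 'm) set \<Rightarrow> bool) \<Rightarrow> ('o, 'm, 'u) psh \<Rightarrow> bool" where
  "is_sheaf C cov P \<longleftrightarrow>
     (\<forall>X\<in>obj C. \<forall>R. cov X R \<longrightarrow>
        (\<forall>s. (\<forall>(W, F)\<in>R. s W F \<in> ob P W) \<and>
             (\<forall>(W, F)\<in>R. \<forall>V\<in>obj C. \<forall>G\<in>hom C V W.
                mp P V W G (s W F) = s V (cmp C V W X F G))
             \<longrightarrow> (\<exists>!x. x \<in> ob P X \<and> (\<forall>(W, F)\<in>R. mp P W X F x = s W F))))"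

text \<open>Restriction along the functor from \<open>Strat n\<close> to \<open>Prestrat n\<close> which is the identity on objects and
  sends the class of a stratified map to its class as a prestratified map.\<close>

definition restrict_to_Strat ::
    "enat \<Rightarrow> (strat, smap set, 'u) psh \<Rightarrow> (strat, smap set, 'u) psh" where
  "restrict_to_Strat n P =
     \<lparr> ob = ob P, mp = (\<lambda>X Y F. mp P X Y (homotopy n prestratified X Y `` F)) \<rparr>"

definition nWhit ::
    "enat \<Rightarrow> 'u set set \<Rightarrow> ((strat, smap set, 'u) psh, strat \<Rightarrow> 'u \<Rightarrow> 'u) cat" where
  "nWhit n U = full_subcategory (presheaf_category U (Prestrat n))
     (\<lambda>P. is_sheaf (Strat n) (covering_sieve n) (restrict_to_Strat n P))"

end

theory Submission
  imports Defs
begin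

text \<open>A presheaf whose restriction is a sheaf is a model of an essentially algebraic theory: besides the
  action of the morphisms there is, for every covering sieve, a partial operation of infinite arity that
  glues matching families, and its values are unique. The colimit of a diagram of sheaves is therefore the
  free model under the diagram, namely well-founded terms in these operations modulo the smallest
  congruence that makes it a model. Well-definedness of terms and their congruence are generated together
  as one partial equivalence relation. The terms are small because the small sets are closed under powers
  with exponent the set of morphisms.\<close>

section \<open>Terms over small sets\<close>

text \<open>Gluing takes place along stratified maps, while prestratified maps have to act as well;
  sheafifying a presheaf colimit over \<open>Strat n\<close> gives no evident action of the latter.
  Adding both kinds of operations freely at once avoids this obstacle. Equality and well-definedness
  are inseparable because a family may be glued only if it matches, which is an equation between
  terms, while glued terms give rise to new equations. The cost is size: arities are infinite and
  terms arbitrarily deep, yet each value of the colimit must be a small set of elements of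
  \<open>'u\<close>. An infinite exponent absorbs its own square, so some small set contains a copy
  of all families of its own elements, and terms of every depth are coded in it by recursion,
  without iteration along ordinals.\<close>

text \<open>\<open>Glue R s\<close> takes a total function \<open>s\<close>; \<open>Junk\<close> is its value outside \<open>R\<close>.\<close>

datatype ('o, 'm, 'b) tm =
    Junk
  | Base 'b
  | Act 'o 'm "('o, 'm, 'b) tm"
  | Glue "('o \<times> 'm) set" "'o \<times> 'm \<Rightarrow> ('o, 'm, 'b) tm"

text \<open>A recursor with arbitrary result type serves twice: for coding terms in a small set, by
  functions that exist only inside a proof, and for evaluation in a sheaf, where \<open>'c\<close>
  is a type of functions of the object.\<close>

primrec tm_fold ::
    "'c \<Rightarrow> ('b \<Rightarrow> 'c) \<Rightarrow> ('o \<Rightarrow> 'm \<Rightarrow> 'c \<Rightarrow> 'c) \<Rightarrow> (('o \<times> 'm) set \<Rightarrow> ('o \<times> 'm \<Rightarrow> 'c) \<Rightarrow> 'c)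
      \<Rightarrow> ('o, 'm, 'b) tm \<Rightarrow> 'c" where
  "tm_fold z b a g Junk = z"
| "tm_fold z b a g (Base x) = b x"
| "tm_fold z b a g (Act Y F t) = a Y F (tm_fold z b a g t)"
| "tm_fold z b a g (Glue R s) = g R (\<lambda>w. tm_fold z b a g (s w))"

section \<open>Coding terms by elements of a small set\<close>

lemma set_universe_subset: "set_universe I U \<Longrightarrow> A \<in> U \<Longrightarrow> B \<subseteq> A \<Longrightarrow> B \<in> U"
  by (simp add: set_universe_def)

lemma set_universe_UN: "set_universe I U \<Longrightarrow> J \<in> U \<Longrightarrow> (\<And>j. j \<in> J \<Longrightarrow> A j \<in> U) \<Longrightarrow> (\<Union>j\<in>J. A j) \<in> U"
  unfolding set_universe_def by (elim conjE) meson

text \<open>Composition with a left inverse of \<open>j\<close> turns families over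
  \<open>'k\<close> into families over \<open>'i\<close>, for which the universe provides a bound.
  Functions are not elements of \<open>'u\<close>, so smallness of a set of functions means an
  injective image in \<open>U\<close>.\<close>

lemma set_universe_power:
  fixes j :: "'k \<Rightarrow> 'i"
  assumes U: "set_universe (UNIV :: 'i set) U" and j: "inj j" and A: "A \<in> U"
  shows "\<exists>f. inj_on f {h :: 'k \<Rightarrow> 'u. range h \<subseteq> A} \<and> f ` {h. range h \<subseteq> A} \<in> U"
proof -
  obtain B where B: "B \<in> U" "((UNIV :: 'i set) \<rightarrow>\<^sub>E A) \<lesssim> B"
    using U A unfolding set_universe_def by (elim conjE) meson
  then obtain f where f: "inj_on f ((UNIV :: 'i set) \<rightarrow>\<^sub>E A)"
    "f ` ((UNIV :: 'i set) \<rightarrow>\<^sub>E A) \<subseteq> B"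
    by (auto simp: lepoll_def)
  let ?g = "\<lambda>h :: 'k \<Rightarrow> 'u. \<lambda>i. h (inv j i)"
  have g: "?g h \<in> UNIV \<rightarrow>\<^sub>E A" if "range h \<subseteq> A" for h
    using that by auto
  have "inj_on (\<lambda>h. f (?g h)) {h. range h \<subseteq> A}"
  proof (rule inj_onI)
    fix h h' assume h: "h \<in> {h. range h \<subseteq> A}" "h' \<in> {h. range h \<subseteq> A}" "f (?g h) = f (?g h')"
    have eq: "?g h = ?g h'"
      by (rule inj_onD[OF f(1)]) (use h g in auto)
    have "h k = h' k" for k
      using fun_cong[OF eq, of "j k"] j by simp
    then show "h = h'" by blast
  qed
  moreover have "(\<lambda>h. f (?g h)) ` {h. range h \<subseteq> A} \<subseteq> B"
    using f(2) g by fastforce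
  ultimately show ?thesis
    using set_universe_subset[OF U B(1)] by blast
qed

lemma set_universe_infinite_superset:
  assumes U: "set_universe I U" and A: "A \<in> U"
  shows "\<exists>B\<in>U. infinite B \<and> A \<subseteq> B"
proof -
  obtain N where N: "N \<in> U" "infinite N" using U by (auto simp: set_universe_def)
  obtain p where p: "p \<in> N" using N(2) by fastforce
  have "infinite (N - {p})" using N(2) by simp
  then obtain q where "q \<in> N - {p}" by (metis finite.emptyI ex_in_conv)
  with p have pq: "p \<in> N" "q \<in> N" "p \<noteq> q" by auto
  \<comment> \<open>A two-point subset of \<open>N\<close> is a small index set, which reduces a
    binary union to an indexed one.\<close>
  have "(\<Union>j\<in>{p, q}. if j = p then A else N) \<in> U"
    using A N pq by (intro set_universe_UN[OF U]) (auto intro: set_universe_subset[OF U N(1)])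
  then have "A \<union> N \<in> U" using pq by (simp add: Un_commute)
  then show ?thesis using N(2) by (intro bexI[of _ "A \<union> N"]) auto
qed

text \<open>In a set that absorbs the families of its own elements, \<open>\<phi>\<close> codes a
  node of a term from the codes of its children. Constant families provide the copy of
  \<open>A\<close>.\<close>

lemma set_universe_closed_power:
  fixes j :: "'k \<Rightarrow> 'i" and U :: "'u set set"
  assumes U: "set_universe (UNIV :: 'i set) U" and j: "inj j" and inf: "infinite (UNIV :: 'k set)"
    and A: "A \<in> U"
  shows "\<exists>C\<in>U. \<exists>\<epsilon> \<phi>. infinite C \<and> inj_on \<epsilon> A \<and> \<epsilon> ` A \<subseteq> C \<and>
    inj_on \<phi> {h :: 'k \<Rightarrow> 'u. range h \<subseteq> C} \<and> \<phi> ` {h. range h \<subseteq> C} \<subseteq> C"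
proof -
  obtain B where B: "B \<in> U" "infinite B" "A \<subseteq> B"
    using set_universe_infinite_superset[OF U A] by blast
  let ?H = "{h :: 'k \<Rightarrow> 'u. range h \<subseteq> B}"
  obtain f where f: "inj_on f ?H" "f ` ?H \<in> U"
    using set_universe_power[OF U j B(1)] by blast
  obtain b :: "'k \<times> 'k \<Rightarrow> 'k" where b: "bij b"
    using card_of_Times_same_infinite[OF inf] by (auto simp: card_of_ordIso[symmetric])
  define C where "C = f ` ?H"
  define \<epsilon> where "\<epsilon> x = f (\<lambda>_. x)" for x
  \<comment> \<open>\<open>C\<close> is a copy of \<open>'k \<Rightarrow> B\<close>, so \<open>'k \<Rightarrow> C\<close> amounts to \<open>'k \<times> 'k \<Rightarrow> B\<close> and hence, through \<open>b\<close>, to \<open>C\<close>.\<close>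
  define g where "g h = (\<lambda>k. inv_into ?H f (h (fst (inv b k))) (snd (inv b k)))" for h
  have \<epsilon>: "inj_on \<epsilon> B" "\<epsilon> ` B \<subseteq> C"
  proof -
    have "x = y" if xy: "x \<in> B" "y \<in> B" "f (\<lambda>_. x) = f (\<lambda>_. y)" for x y
    proof -
      have "(\<lambda>_. x) = (\<lambda>_ :: 'k. y)"
        by (rule inj_onD[OF f(1)]) (use xy in auto)
      then show ?thesis by (rule fun_cong)
    qed
    then show "inj_on \<epsilon> B" by (auto simp: inj_on_def \<epsilon>_def)
    show "\<epsilon> ` B \<subseteq> C" by (auto simp: \<epsilon>_def C_def)
  qed
  have inv: "inv_into ?H f c \<in> ?H" "f (inv_into ?H f c) = c" if "c \<in> C" for c
    using inv_into_into[OF that[unfolded C_def]] f_inv_into_f[OF that[unfolded C_def]] by this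
  have g: "g h \<in> ?H" if "range h \<subseteq> C" for h
    using that inv(1) by (fastforce simp: g_def)
  have "inj_on g {h. range h \<subseteq> C}"
  proof (rule inj_onI)
    fix h h' assume h: "h \<in> {h. range h \<subseteq> C}" "h' \<in> {h. range h \<subseteq> C}" and eq: "g h = g h'"
    have "inv_into ?H f (h k) l = inv_into ?H f (h' k) l" for k l
      using fun_cong[OF eq, of "b (k, l)"] b by (simp add: g_def bij_is_inj)
    then have "inv_into ?H f (h k) = inv_into ?H f (h' k)" for k by blast
    then have "h k = h' k" for k
      using inv(2)[of "h k"] inv(2)[of "h' k"] h(1,2) by (metis (lifting) mem_Collect_eq range_subsetD)
    then show "h = h'" by blast
  qed
  then have "inj_on (f \<circ> g) {h. range h \<subseteq> C}"
    by (rule comp_inj_on, intro inj_on_subset[OF f(1)] image_subsetI g) blast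
  moreover have "(f \<circ> g) ` {h. range h \<subseteq> C} \<subseteq> C"
    using g by (auto simp: C_def)
  moreover have "infinite C"
    using \<epsilon> B(2) by (meson finite_imageD finite_subset)
  moreover have "inj_on \<epsilon> A" "\<epsilon> ` A \<subseteq> C"
    using \<epsilon> B(3) by (auto intro: inj_on_subset)
  ultimately show ?thesis
    using f(2) unfolding C_def[symmetric] by (intro bexI[of _ C] exI conjI)
qed

text \<open>Pairs of codes and subsets of \<open>'o \<times> 'm\<close> can be written as families
  over \<open>'o \<times> 'm\<close>, just like the arguments of \<open>Glue\<close>, so
  \<open>\<phi>\<close> alone codes every constructor.\<close>

lemma small_set_of_terms:
  fixes j :: "'o \<times> 'm \<Rightarrow> 'i" and U :: "'u set set"
  assumes U: "set_universe (UNIV :: 'i set) U" and j: "inj j"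
    and inf: "infinite (UNIV :: ('o \<times> 'm) set)" and A: "A \<in> U"
  shows "\<exists>e. inj_on e {t :: ('o, 'm, 'u \<times> 'u) tm. set_tm t \<subseteq> A \<times> A} \<and>
    e ` {t. set_tm t \<subseteq> A \<times> A} \<in> U"
proof -
  obtain C \<epsilon> \<phi> where C: "C \<in> U" "infinite C" and \<epsilon>: "inj_on \<epsilon> A" "\<epsilon> ` A \<subseteq> C"
    and \<phi>: "inj_on \<phi> {h :: 'o \<times> 'm \<Rightarrow> 'u. range h \<subseteq> C}" "\<phi> ` {h. range h \<subseteq> C} \<subseteq> C"
    using set_universe_closed_power[OF U j inf A] by blast
  obtain p where p: "p \<in> C" using C(2) by fastforce
  have "infinite (C - {p})" using C(2) by simp
  then obtain q where "q \<in> C - {p}" by (metis finite.emptyI ex_in_conv)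
  then have q: "q \<in> C" "p \<noteq> q" by auto
  obtain v :: "'o \<times> 'm" where "v \<in> UNIV" by blast
  have "infinite (UNIV - {v})" using inf by simp
  then obtain v' where v: "v' \<noteq> v" by (metis DiffE finite.emptyI ex_in_conv singletonI)
  have \<phi>_eq: "\<phi> h = \<phi> h' \<longleftrightarrow> h = h'" if "range h \<subseteq> C" "range h' \<subseteq> C" for h h'
    using \<phi>(1) that by (auto dest: inj_onD)
  have \<phi>_in: "\<phi> h \<in> C" if "range h \<subseteq> C" for h
    using \<phi>(2) that by blast
  \<comment> \<open>The first coordinate sits at \<open>v\<close>, the second at all other indices;
    the existence of \<open>v'\<close> makes the second recoverable.\<close>
  define pr where "pr c d = \<phi> (\<lambda>w. if w = v then c else d)" for c d
  have pr_in: "pr c d \<in> C" if "c \<in> C" "d \<in> C" for c d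
    unfolding pr_def using that by (intro \<phi>_in) auto
  have pr_eq: "pr c d = pr c' d' \<longleftrightarrow> c = c' \<and> d = d'"
    if "c \<in> C" "d \<in> C" "c' \<in> C" "d' \<in> C" for c d c' d'
  proof -
    have "pr c d = pr c' d' \<longleftrightarrow> (\<lambda>w. if w = v then c else d) = (\<lambda>w. if w = v then c' else d')"
      unfolding pr_def using that by (intro \<phi>_eq) auto
    also have "\<dots> \<longleftrightarrow> c = c' \<and> d = d'"
    proof
      assume eq: "(\<lambda>w. if w = v then c else d) = (\<lambda>w. if w = v then c' else d')"
      from fun_cong[OF eq, of v] fun_cong[OF eq, of v'] v show "c = c' \<and> d = d'" by simp
    qed (elim conjE, simp only:)
    finally show ?thesis .
  qed
  define sc where "sc R = \<phi> (\<lambda>w. if w \<in> R then p else q)" for R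
  have sc_in: "sc R \<in> C" for R
    unfolding sc_def using p q by (intro \<phi>_in) auto
  have sc_eq: "sc R = sc R' \<longleftrightarrow> R = R'" for R R'
  proof -
    have "sc R = sc R' \<longleftrightarrow> (\<lambda>w. if w \<in> R then p else q) = (\<lambda>w. if w \<in> R' then p else q)"
      unfolding sc_def using p q by (intro \<phi>_eq) auto
    also have "\<dots> \<longleftrightarrow> R = R'"
    proof
      assume eq: "(\<lambda>w. if w \<in> R then p else q) = (\<lambda>w. if w \<in> R' then p else q)"
      have "w \<in> R \<longleftrightarrow> w \<in> R'" for w
        using fun_cong[OF eq, of w] q(2) by (cases "w \<in> R"; cases "w \<in> R'") simp_all
      then show "R = R'" by blast
    qed (simp only:)
    finally show ?thesis .
  qed
  \<comment> \<open>The four pairs formed from \<open>p\<close> and \<open>q\<close> tag the four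
    constructors. The morphism in \<open>Act\<close> is coded through a singleton set, so that
    \<open>sc\<close> serves for it as well.\<close>
  define e :: "('o, 'm, 'u \<times> 'u) tm \<Rightarrow> 'u" where
    "e = tm_fold (pr (pr q q) p) (\<lambda>(x, y). pr (pr p p) (pr (\<epsilon> x) (\<epsilon> y)))
       (\<lambda>Y F c. pr (pr p q) (pr (sc {(Y, F)}) c)) (\<lambda>R s. pr (pr q p) (pr (sc R) (\<phi> s)))"
  have e_simps:
    "e Junk = pr (pr q q) p" "e (Base (x, y)) = pr (pr p p) (pr (\<epsilon> x) (\<epsilon> y))"
    "e (Act Y F t) = pr (pr p q) (pr (sc {(Y, F)}) (e t))"
    "e (Glue R s) = pr (pr q p) (pr (sc R) (\<phi> (\<lambda>w. e (s w))))" for x y Y F t R s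
    by (simp_all add: e_def)
  note ins = pr_in sc_in \<phi>_in p q
  have \<epsilon>_in: "\<epsilon> x \<in> C" if "x \<in> A" for x using that \<epsilon>(2) by blast
  have e_in: "e t \<in> C" if "set_tm t \<subseteq> A \<times> A" for t
    using that
  proof (induction t)
    case (Base x)
    then show ?case by (cases x) (auto simp: e_simps intro!: ins \<epsilon>_in)
  next
    case (Glue R s)
    then have "e (s w) \<in> C" for w by auto
    then have "range (\<lambda>w. e (s w)) \<subseteq> C" by blast
    then show ?case by (simp add: e_simps ins)
  qed (simp_all add: e_simps ins)
  have e_range: "range (\<lambda>w. e (s w)) \<subseteq> C" if "set_tm (Glue R s) \<subseteq> A \<times> A" for R s
  proof -
    have "e (s w) \<in> C" for w using that by (intro e_in) auto
    then show ?thesis by blast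
  qed
  have e_eq: "t = t'" if "set_tm t \<subseteq> A \<times> A" "set_tm t' \<subseteq> A \<times> A" "e t = e t'" for t t'
    using that
  proof (induction t arbitrary: t')
    case Junk
    then show ?case
      by (cases t') (auto simp: e_simps pr_eq ins e_in \<epsilon>_in e_range q(2)[symmetric] simp del: tm.set(4))
  next
    case (Base x)
    then show ?case
      using \<epsilon>(1) by (cases t'; cases x)
        (auto simp: e_simps pr_eq ins e_in \<epsilon>_in e_range q(2)[symmetric] simp del: tm.set(4) dest: inj_onD)
  next
    case (Act Y F t)
    then show ?case
      by (cases t')
        (auto simp: e_simps pr_eq sc_eq ins e_in \<epsilon>_in e_range q(2)[symmetric] simp del: tm.set(4))
  next
    case (Glue R s)
    show ?case
    proof (cases t')
      case Glue': (Glue R' s')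
      have s: "set_tm (s w) \<subseteq> A \<times> A" "set_tm (s' w) \<subseteq> A \<times> A" for w
        using Glue.prems(1,2) unfolding Glue' tm.set by blast+
      have r: "range (\<lambda>w. e (s w)) \<subseteq> C" "range (\<lambda>w. e (s' w)) \<subseteq> C"
        using e_range Glue.prems(1,2) unfolding Glue' by blast+
      have "\<phi> (\<lambda>w. e (s w)) = \<phi> (\<lambda>w. e (s' w))" and R: "R = R'"
        using Glue.prems(3) r unfolding Glue' by (simp_all add: e_simps pr_eq sc_eq ins)
      then have "(\<lambda>w. e (s w)) = (\<lambda>w. e (s' w))"
        using \<phi>_eq[OF r] by simp
      then have "e (s w) = e (s' w)" for w by (rule fun_cong)
      then have "s w = s' w" for w using s by (intro Glue.IH) auto
      then show ?thesis using R Glue' by blast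
    qed (use Glue.prems in \<open>auto simp: e_simps pr_eq ins e_in \<epsilon>_in e_range q(2)[symmetric] simp del: tm.set(4)\<close>)
  qed
  have "inj_on e {t. set_tm t \<subseteq> A \<times> A}"
    using e_eq by (auto simp: inj_on_def)
  moreover have "e ` {t. set_tm t \<subseteq> A \<times> A} \<in> U"
    by (rule set_universe_subset[OF U C(1)]) (use e_in in auto)
  ultimately show ?thesis by blast
qed

section \<open>Presheaves that are sheaves on a site with the same objects\<close>

text \<open>\<open>S\<close> carries the gluing conditions and \<open>C\<close> the action. For
  Whitney categories they are \<open>Strat n\<close> and \<open>Prestrat n\<close>, and
  \<open>\<iota>\<close> passes to the coarser homotopy class.\<close>

locale restricted_site =
  fixes C S :: "('o, 'm) cat" and \<iota> :: "'o \<Rightarrow> 'o \<Rightarrow> 'm \<Rightarrow> 'm"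
    and cov :: "'o \<Rightarrow> ('o \<times> 'm) set \<Rightarrow> bool"
  assumes obj_S: "obj S = obj C"
    and \<iota>_hom: "X \<in> obj C \<Longrightarrow> Y \<in> obj C \<Longrightarrow> F \<in> hom S X Y \<Longrightarrow> \<iota> X Y F \<in> hom C X Y"
    and cov_obj: "X \<in> obj C \<Longrightarrow> cov X R \<Longrightarrow> (W, F) \<in> R \<Longrightarrow> W \<in> obj C"
    and cov_hom: "X \<in> obj C \<Longrightarrow> cov X R \<Longrightarrow> (W, F) \<in> R \<Longrightarrow> F \<in> hom S W X"
    and cov_cmp: "X \<in> obj C \<Longrightarrow> cov X R \<Longrightarrow> (W, F) \<in> R \<Longrightarrow> V \<in> obj C \<Longrightarrow> G \<in> hom S V W \<Longrightarrow>
      (V, cmp S V W X F G) \<in> R"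
begin

definition sheaf :: "('o, 'm, 'u) psh \<Rightarrow> bool" where
  "sheaf P \<longleftrightarrow> is_sheaf S cov \<lparr> ob = ob P, mp = (\<lambda>X Y F. mp P X Y (\<iota> X Y F)) \<rparr>"

definition matching :: "('o, 'm, 'u) psh \<Rightarrow> 'o \<Rightarrow> ('o \<times> 'm) set \<Rightarrow> ('o \<times> 'm \<Rightarrow> 'u) \<Rightarrow> bool" where
  "matching P X R s \<longleftrightarrow> (\<forall>(W, F)\<in>R. s (W, F) \<in> ob P W \<and>
     (\<forall>V\<in>obj C. \<forall>G\<in>hom S V W. mp P V W (\<iota> V W G) (s (W, F)) = s (V, cmp S V W X F G)))"

definition amalgamation :: "('o, 'm, 'u) psh \<Rightarrow> 'o \<Rightarrow> ('o \<times> 'm) set \<Rightarrow> ('o \<times> 'm \<Rightarrow> 'u) \<Rightarrow> 'u \<Rightarrow> bool"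
  where "amalgamation P X R s x \<longleftrightarrow>
     x \<in> ob P X \<and> (\<forall>(W, F)\<in>R. mp P W X (\<iota> W X F) x = s (W, F))"

text \<open>Families on a sieve become functions of pairs, the form in which \<open>Glue\<close>
  takes its argument; the two directions are \<open>curry\<close> and
  \<open>case_prod\<close>.\<close>

lemma sheaf_iff:
  "sheaf P \<longleftrightarrow> (\<forall>X\<in>obj C. \<forall>R s. cov X R \<longrightarrow> matching P X R s \<longrightarrow> (\<exists>!x. amalgamation P X R s x))"
proof
  assume P: "sheaf P"
  show "\<forall>X\<in>obj C. \<forall>R s. cov X R \<longrightarrow> matching P X R s \<longrightarrow> (\<exists>!x. amalgamation P X R s x)"
  proof (intro ballI allI impI)
    fix X R s assume X: "X \<in> obj C" "cov X R" and s: "matching P X R s"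
    from P X have "(\<forall>(W, F)\<in>R. curry s W F \<in> ob P W) \<and>
             (\<forall>(W, F)\<in>R. \<forall>V\<in>obj C. \<forall>G\<in>hom S V W.
                mp P V W (\<iota> V W G) (curry s W F) = curry s V (cmp S V W X F G))
             \<longrightarrow> (\<exists>!x. x \<in> ob P X \<and> (\<forall>(W, F)\<in>R. mp P W X (\<iota> W X F) x = curry s W F))"
      unfolding sheaf_def is_sheaf_def obj_S psh.simps by blast
    with s show "\<exists>!x. amalgamation P X R s x"
      unfolding matching_def amalgamation_def curry_conv by (elim impE) blast+
  qed
next
  assume P: "\<forall>X\<in>obj C. \<forall>R s. cov X R \<longrightarrow> matching P X R s \<longrightarrow> (\<exists>!x. amalgamation P X R s x)"
  show "sheaf P"
    unfolding sheaf_def is_sheaf_def obj_S psh.simps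
  proof (intro ballI allI impI)
    fix X R s assume X: "X \<in> obj C" "cov X R"
      and s: "(\<forall>(W, F)\<in>R. s W F \<in> ob P W) \<and>
             (\<forall>(W, F)\<in>R. \<forall>V\<in>obj C. \<forall>G\<in>hom S V W.
                mp P V W (\<iota> V W G) (s W F) = s V (cmp S V W X F G))"
    have "matching P X R (case_prod s)"
      using s unfolding matching_def prod.case by blast
    with P X have "\<exists>!x. amalgamation P X R (case_prod s) x" by blast
    then show "\<exists>!x. x \<in> ob P X \<and> (\<forall>(W, F)\<in>R. mp P W X (\<iota> W X F) x = s W F)"
      unfolding amalgamation_def prod.case .
  qed
qed

lemma amalgamation_the:
  assumes "sheaf P" "X \<in> obj C" "cov X R" "matching P X R s"
  shows "amalgamation P X R s (THE x. amalgamation P X R s x)"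
  using assms theI'[of "amalgamation P X R s"] unfolding sheaf_iff by blast

lemma amalgamation_unique:
  assumes "sheaf P" "X \<in> obj C" "cov X R" "matching P X R s"
    and "amalgamation P X R s x" "amalgamation P X R s y"
  shows "x = y"
  using assms unfolding sheaf_iff by blast

lemma amalgamation_cong:
  "(\<And>W F. (W, F) \<in> R \<Longrightarrow> s (W, F) = s' (W, F)) \<Longrightarrow> amalgamation P X R s = amalgamation P X R s'"
  unfolding amalgamation_def by (auto simp: fun_eq_iff)

end

section \<open>Elementary rules for presheaves and natural transformations\<close>

lemma presheaf_mp_in:
  assumes "is_presheaf U C P" "X \<in> obj C" "Y \<in> obj C" "F \<in> hom C X Y" "x \<in> ob P Y"
  shows "mp P X Y F x \<in> ob P X"
  using assms unfolding is_presheaf_def by blast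

lemma presheaf_id:
  assumes "is_presheaf U C P" "X \<in> obj C" "x \<in> ob P X"
  shows "mp P X X (idn C X) x = x"
  using assms unfolding is_presheaf_def by blast

lemma presheaf_cmp:
  assumes "is_presheaf U C P" "X \<in> obj C" "Y \<in> obj C" "Z \<in> obj C"
    "F \<in> hom C X Y" "G \<in> hom C Y Z" "x \<in> ob P Z"
  shows "mp P X Z (cmp C X Y Z G F) x = mp P X Y F (mp P Y Z G x)"
  using assms unfolding is_presheaf_def by blast

lemma nat_trans_in:
  assumes "\<eta> \<in> nat_trans C P Q" "X \<in> obj C" "x \<in> ob P X"
  shows "\<eta> X x \<in> ob Q X"
  using assms unfolding nat_trans_def by blast

lemma nat_trans_mp:
  assumes "\<eta> \<in> nat_trans C P Q" "X \<in> obj C" "Y \<in> obj C" "F \<in> hom C X Y" "y \<in> ob P Y"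
  shows "\<eta> X (mp P X Y F y) = mp Q X Y F (\<eta> Y y)"
  using assms unfolding nat_trans_def by blast

lemma nat_transI:
  assumes "\<And>X. X \<in> obj C \<Longrightarrow> \<eta> X \<in> ob P X \<rightarrow>\<^sub>E ob Q X" "\<And>X. X \<notin> obj C \<Longrightarrow> \<eta> X = undefined"
    and "\<And>X Y F y. X \<in> obj C \<Longrightarrow> Y \<in> obj C \<Longrightarrow> F \<in> hom C X Y \<Longrightarrow> y \<in> ob P Y \<Longrightarrow>
      \<eta> X (mp P X Y F y) = mp Q X Y F (\<eta> Y y)"
  shows "\<eta> \<in> nat_trans C P Q"
  using assms unfolding nat_trans_def by (auto intro!: PiE_I)

lemma nat_trans_eqI:
  assumes "\<eta> \<in> nat_trans C P Q" "\<theta> \<in> nat_trans C P Q"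
    and "\<And>X x. X \<in> obj C \<Longrightarrow> x \<in> ob P X \<Longrightarrow> \<eta> X x = \<theta> X x"
  shows "\<eta> = \<theta>"
proof (rule PiE_ext)
  show \<eta>: "\<eta> \<in> (\<Pi>\<^sub>E X\<in>obj C. ob P X \<rightarrow>\<^sub>E ob Q X)" and \<theta>: "\<theta> \<in> (\<Pi>\<^sub>E X\<in>obj C. ob P X \<rightarrow>\<^sub>E ob Q X)"
    using assms(1,2) by (simp_all add: nat_trans_def)
  show "\<eta> X = \<theta> X" if "X \<in> obj C" for X
    using assms(3) that by (intro PiE_ext[OF PiE_mem[OF \<eta> that] PiE_mem[OF \<theta> that]])
qed

section \<open>The free sheaf under a diagram\<close>

locale presheaf_diagram = restricted_site C S \<iota> cov
  for C S :: "('o, 'm) cat" and \<iota> cov +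
  fixes U :: "'u set set" and J :: "('u, 'u) cat" and D :: "'u \<Rightarrow> ('o, 'm, 'u) psh"
    and DD :: "'u \<Rightarrow> 'u \<Rightarrow> 'u \<Rightarrow> 'o \<Rightarrow> 'u \<Rightarrow> 'u"
  assumes D: "i \<in> obj J \<Longrightarrow> is_presheaf U C (D i)"
    and DD: "i \<in> obj J \<Longrightarrow> j \<in> obj J \<Longrightarrow> a \<in> hom J i j \<Longrightarrow> DD i j a \<in> nat_trans C (D i) (D j)"
begin

text \<open>\<open>rel X t t'\<close> says that \<open>t\<close> and \<open>t'\<close> are well-defined and equal over \<open>X\<close>. The last premise of
  \<open>separated\<close>, that the restrictions of \<open>t\<close> form a matching family, would be redundant if \<open>\<iota>\<close> were known to
  preserve composition; this is avoided since it would require composites of prestratified maps.\<close>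

inductive rel :: "'o \<Rightarrow> ('o, 'm, 'u \<times> 'u) tm \<Rightarrow> ('o, 'm, 'u \<times> 'u) tm \<Rightarrow> bool" where
  base: "X \<in> obj C \<Longrightarrow> i \<in> obj J \<Longrightarrow> x \<in> ob (D i) X \<Longrightarrow> rel X (Base (i, x)) (Base (i, x))"
| diagram: "X \<in> obj C \<Longrightarrow> i \<in> obj J \<Longrightarrow> j \<in> obj J \<Longrightarrow> a \<in> hom J i j \<Longrightarrow> x \<in> ob (D i) X \<Longrightarrow>
    rel X (Base (j, DD i j a X x)) (Base (i, x))"
| base_act: "X \<in> obj C \<Longrightarrow> Y \<in> obj C \<Longrightarrow> F \<in> hom C X Y \<Longrightarrow> i \<in> obj J \<Longrightarrow> x \<in> ob (D i) Y \<Longrightarrow>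
    rel X (Act Y F (Base (i, x))) (Base (i, mp (D i) X Y F x))"
| sym: "rel X t t' \<Longrightarrow> rel X t' t"
| trans: "rel X t t' \<Longrightarrow> rel X t' t'' \<Longrightarrow> rel X t t''"
| act: "X \<in> obj C \<Longrightarrow> Y \<in> obj C \<Longrightarrow> F \<in> hom C X Y \<Longrightarrow> rel Y t t' \<Longrightarrow>
    rel X (Act Y F t) (Act Y F t')"
| act_id: "X \<in> obj C \<Longrightarrow> rel X t t \<Longrightarrow> rel X (Act X (idn C X) t) t"
| act_cmp: "X \<in> obj C \<Longrightarrow> Y \<in> obj C \<Longrightarrow> Z \<in> obj C \<Longrightarrow> F \<in> hom C X Y \<Longrightarrow> G \<in> hom C Y Z \<Longrightarrow>
    rel Z t t \<Longrightarrow> rel X (Act Z (cmp C X Y Z G F) t) (Act Y F (Act Z G t))"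
| glue: "X \<in> obj C \<Longrightarrow> cov X R \<Longrightarrow> (\<And>W F. (W, F) \<in> R \<Longrightarrow> rel W (s (W, F)) (s' (W, F))) \<Longrightarrow>
    (\<And>W F V G. (W, F) \<in> R \<Longrightarrow> V \<in> obj C \<Longrightarrow> G \<in> hom S V W \<Longrightarrow>
       rel V (Act W (\<iota> V W G) (s (W, F))) (s (V, cmp S V W X F G))) \<Longrightarrow>
    (\<And>w. w \<notin> R \<Longrightarrow> s w = Junk \<and> s' w = Junk) \<Longrightarrow> rel X (Glue R s) (Glue R s')"
| glue_act: "X \<in> obj C \<Longrightarrow> cov X R \<Longrightarrow> (\<And>W F. (W, F) \<in> R \<Longrightarrow> rel W (s (W, F)) (s (W, F))) \<Longrightarrow>
    (\<And>W F V G. (W, F) \<in> R \<Longrightarrow> V \<in> obj C \<Longrightarrow> G \<in> hom S V W \<Longrightarrow>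
       rel V (Act W (\<iota> V W G) (s (W, F))) (s (V, cmp S V W X F G))) \<Longrightarrow>
    (\<And>w. w \<notin> R \<Longrightarrow> s w = Junk) \<Longrightarrow> (W, F) \<in> R \<Longrightarrow>
    rel W (Act X (\<iota> W X F) (Glue R s)) (s (W, F))"
| separated: "X \<in> obj C \<Longrightarrow> cov X R \<Longrightarrow> rel X t t \<Longrightarrow> rel X t' t' \<Longrightarrow>
    (\<And>W F. (W, F) \<in> R \<Longrightarrow> rel W (Act X (\<iota> W X F) t) (Act X (\<iota> W X F) t')) \<Longrightarrow>
    (\<And>W F V G. (W, F) \<in> R \<Longrightarrow> V \<in> obj C \<Longrightarrow> G \<in> hom S V W \<Longrightarrow>
       rel V (Act W (\<iota> V W G) (Act X (\<iota> W X F) t)) (Act X (\<iota> V X (cmp S V W X F G)) t)) \<Longrightarrow>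
    rel X t t'"

lemma rel_obj: "rel X t t' \<Longrightarrow> X \<in> obj C"
  by (induction rule: rel.induct) (auto intro: cov_obj)

lemma rel_refl: "rel X t t' \<Longrightarrow> rel X t t" "rel X t t' \<Longrightarrow> rel X t' t'"
  using rel.sym rel.trans by blast+

definition labels :: "'u set" where
  "labels = obj J \<union> (\<Union>i\<in>obj J. \<Union>X\<in>obj C. ob (D i) X)"

lemma labels: "i \<in> obj J \<Longrightarrow> i \<in> labels" "i \<in> obj J \<Longrightarrow> X \<in> obj C \<Longrightarrow> x \<in> ob (D i) X \<Longrightarrow> x \<in> labels"
  by (auto simp: labels_def)

text \<open>This bounds the terms in play. The labels of \<open>Glue R s\<close> are collected over
  all arguments of \<open>s\<close>; those outside \<open>R\<close> contribute nothing because the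
  clauses force \<open>Junk\<close> there.\<close>

lemma rel_labels:
  "rel X t t' \<Longrightarrow> set_tm t \<subseteq> labels \<times> labels \<and> set_tm t' \<subseteq> labels \<times> labels"
proof (induction rule: rel.induct)
  case (diagram X i j a x)
  then show ?case
    using nat_trans_in[OF DD] labels by auto
next
  case (base_act X Y F i x)
  then show ?case
    using presheaf_mp_in[OF D] labels by auto
next
  case (glue X R s s')
  have "set_tm (s w) \<subseteq> labels \<times> labels \<and> set_tm (s' w) \<subseteq> labels \<times> labels" for w
    using glue.IH(1) glue.hyps(5) by (cases "w \<in> R"; cases w) auto
  then show ?case by auto
next
  case (glue_act X R s W F)
  have "set_tm (s w) \<subseteq> labels \<times> labels" for w
    using glue_act.IH(1) glue_act.hyps(5) by (cases "w \<in> R"; cases w) auto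
  then show ?case by auto
qed (auto intro: labels)

end

section \<open>The quotient as a small sheaf\<close>

locale small_presheaf_diagram = presheaf_diagram C S \<iota> cov U J D DD
  for C S :: "('o, 'm) cat" and \<iota> cov and U :: "'u set set" and J D DD +
  assumes U: "set_universe (UNIV :: ('o \<times> 'o \<times> 'm) set) U"
    and inf: "infinite (UNIV :: ('o \<times> 'm) set)"
    and J: "obj J \<in> U"
begin

text \<open>Unions in \<open>U\<close> run over sets of elements of \<open>'u\<close>, whereas
  objects have type \<open>'o\<close>. Hence \<open>\<delta>\<close> codes an object by the
  indicator function of its singleton, with two values in a small infinite set, which is possible
  since \<open>'o\<close> embeds into the exponent of \<open>U\<close>.\<close>

lemma labels_small: "labels \<in> U"
proof -
  have j: "inj (\<lambda>X :: 'o. (X, X, undefined :: 'm))" by (auto simp: inj_on_def)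
  obtain N where N: "N \<in> U" "infinite N" using U by (auto simp: set_universe_def)
  obtain f where f: "inj_on f {h :: 'o \<Rightarrow> 'u. range h \<subseteq> N}" "f ` {h. range h \<subseteq> N} \<in> U"
    using set_universe_power[OF U j N(1)] by blast
  obtain p where p: "p \<in> N" using N(2) by fastforce
  have "infinite (N - {p})" using N(2) by simp
  then obtain q where "q \<in> N - {p}" by (metis finite.emptyI ex_in_conv)
  then have q: "q \<in> N" "p \<noteq> q" by auto
  define \<delta> where "\<delta> X = f (\<lambda>Y :: 'o. if Y = X then p else q)" for X
  have "inj \<delta>"
  proof (rule injI)
    fix X X' assume "\<delta> X = \<delta> X'"
    then have eq: "(\<lambda>Y. if Y = X then p else q) = (\<lambda>Y. if Y = X' then p else q)"
      unfolding \<delta>_def by (rule inj_onD[OF f(1)]) (use p q in auto)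
    show "X = X'" using fun_cong[OF eq, of X] q(2) by (simp split: if_splits)
  qed
  have range: "range \<delta> \<in> U"
    using p q by (intro set_universe_subset[OF U f(2)]) (auto simp: \<delta>_def)
  have empty: "{} \<in> U" using set_universe_subset[OF U N(1)] by simp
  have ob: "(\<Union>X\<in>obj C. ob (D i) X) \<in> U" if i: "i \<in> obj J" for i
  proof -
    have "(\<Union>z\<in>range \<delta>. if inv \<delta> z \<in> obj C then ob (D i) (inv \<delta> z) else {}) \<in> U"
      using D[OF i] empty by (intro set_universe_UN[OF U range]) (auto simp: is_presheaf_def)
    moreover have "(\<Union>z\<in>range \<delta>. if inv \<delta> z \<in> obj C then ob (D i) (inv \<delta> z) else {}) =
        (\<Union>X\<in>obj C. ob (D i) X)"
      using \<open>inj \<delta>\<close> by (fastforce split: if_splits)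
    ultimately show ?thesis by simp
  qed
  have "(\<Union>i\<in>obj J. \<Union>X\<in>obj C. ob (D i) X) \<in> U"
    using ob by (intro set_universe_UN[OF U J])
  then have "(\<Union>j\<in>{p, q}. if j = p then obj J else (\<Union>i\<in>obj J. \<Union>X\<in>obj C. ob (D i) X)) \<in> U"
    using J p q by (intro set_universe_UN[OF U]) (auto intro: set_universe_subset[OF U N(1)])
  then show ?thesis using q(2) by (simp add: labels_def Un_commute)
qed

lemma ex_code:
  "\<exists>e. inj_on e {t. \<exists>X t'. rel X t t'} \<and> e ` {t. \<exists>X t'. rel X t t'} \<in> U"
proof -
  \<comment> \<open>The exponent of \<open>U\<close> has the type of morphisms with source and
    target. A member of a sieve comes with its source only, which fills both places.\<close>
  have j: "inj (\<lambda>(X :: 'o, F :: 'm). (X, X, F))" by (auto simp: inj_on_def)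
  obtain e where e: "inj_on e {t :: ('o, 'm, 'u \<times> 'u) tm. set_tm t \<subseteq> labels \<times> labels}"
    "e ` {t. set_tm t \<subseteq> labels \<times> labels} \<in> U"
    using small_set_of_terms[OF U j inf labels_small] by blast
  have sub: "{t. \<exists>X t'. rel X t t'} \<subseteq> {t. set_tm t \<subseteq> labels \<times> labels}"
    using rel_labels by blast
  show ?thesis
    using inj_on_subset[OF e(1) sub] set_universe_subset[OF U e(2) image_mono[OF sub]] by blast
qed

definition code :: "('o, 'm, 'u \<times> 'u) tm \<Rightarrow> 'u" where
  "code = (SOME e. inj_on e {t. \<exists>X t'. rel X t t'} \<and> e ` {t. \<exists>X t'. rel X t t'} \<in> U)"

lemma code: "inj_on code {t. \<exists>X t'. rel X t t'}" "code ` {t. \<exists>X t'. rel X t t'} \<in> U"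
  using someI_ex[OF ex_code] unfolding code_def by auto

text \<open>Elements of a presheaf have type \<open>'u\<close>, so a class is represented by the
  code of a chosen member rather than by a set of terms.\<close>

definition cls :: "'o \<Rightarrow> ('o, 'm, 'u \<times> 'u) tm \<Rightarrow> 'u" where
  "cls X t = code (SOME t'. rel X t t')"

definition rep :: "'o \<Rightarrow> 'u \<Rightarrow> ('o, 'm, 'u \<times> 'u) tm" where
  "rep X z = (SOME t. rel X t t \<and> cls X t = z)"

definition L :: "('o, 'm, 'u) psh" where
  "L = \<lparr> ob = (\<lambda>X. cls X ` {t. rel X t t}), mp = (\<lambda>X Y F z. cls X (Act Y F (rep Y z))) \<rparr>"

lemma cls_some: "rel X t t \<Longrightarrow> rel X t (SOME t'. rel X t t')"
  by (rule someI)

text \<open>Related terms define the same predicate \<open>rel X t\<close>, so the same member is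
  chosen. Conversely, injectivity of \<open>code\<close> makes the chosen members equal, and this
  common member links the two terms.\<close>

lemma cls_eq_iff:
  assumes "rel X t t" "rel X t' t'"
  shows "cls X t = cls X t' \<longleftrightarrow> rel X t t'"
proof
  assume "rel X t t'"
  then have "rel X t = rel X t'" using rel.sym rel.trans by blast
  then show "cls X t = cls X t'" by (simp add: cls_def)
next
  let ?a = "SOME t'. rel X t t'" and ?b = "SOME t''. rel X t' t''"
  assume "cls X t = cls X t'"
  moreover have ab: "rel X t ?a" "rel X t' ?b" using assms by (auto intro: cls_some)
  ultimately have "?a = ?b"
    unfolding cls_def by (intro inj_onD[OF code(1)]) (use ab in \<open>auto dest: rel_refl(2)\<close>)
  with ab show "rel X t t'" using rel.sym rel.trans by metis
qed

lemma cls_eq: "rel X t t' \<Longrightarrow> cls X t = cls X t'"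
  using cls_eq_iff rel_refl by blast

lemma cls_in: "rel X t t' \<Longrightarrow> cls X t \<in> ob L X"
  using rel_refl(1) by (auto simp: L_def)

lemma rep:
  assumes "z \<in> ob L X"
  shows "rel X (rep X z) (rep X z)" "cls X (rep X z) = z"
proof -
  have "\<exists>t. rel X t t \<and> cls X t = z" using assms by (auto simp: L_def)
  from someI_ex[OF this] show "rel X (rep X z) (rep X z)" "cls X (rep X z) = z"
    unfolding rep_def by blast+
qed

lemma ob_L_cases:
  assumes "z \<in> ob L X"
  obtains t where "rel X t t" "z = cls X t"
  using rep[OF assms] by metis

lemma rep_cls: "rel X t t \<Longrightarrow> rel X (rep X (cls X t)) t"
  using rep[OF cls_in] cls_eq_iff by blast

lemma mp_L:
  assumes "X \<in> obj C" "Y \<in> obj C" "F \<in> hom C X Y" "rel Y t t"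
  shows "mp L X Y F (cls Y t) = cls X (Act Y F t)"
proof -
  have "cls X (Act Y F (rep Y (cls Y t))) = cls X (Act Y F t)"
    using assms by (intro cls_eq rel.act rep_cls)
  then show ?thesis by (simp add: L_def)
qed

lemma presheaf_L: "is_presheaf U C L"
  unfolding is_presheaf_def
proof (intro conjI ballI)
  show "ob L X \<in> U" for X
  proof (rule set_universe_subset[OF U code(2)])
    show "ob L X \<subseteq> code ` {t. \<exists>X t'. rel X t t'}"
      using cls_some rel_refl(2) by (fastforce simp: L_def cls_def)
  qed
  show "mp L X Y F \<in> ob L Y \<rightarrow> ob L X" if X: "X \<in> obj C" "Y \<in> obj C" "F \<in> hom C X Y" for X Y F
  proof
    fix z assume "z \<in> ob L Y"
    then obtain t where t: "rel Y t t" "z = cls Y t" by (rule ob_L_cases)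
    show "mp L X Y F z \<in> ob L X"
      unfolding t(2) mp_L[OF X t(1)] by (rule cls_in[OF rel.act[OF X t(1)]])
  qed
  show "mp L X X (idn C X) x = x" if X: "X \<in> obj C" "x \<in> ob L X" for X x
  proof -
    obtain t where t: "rel X t t" "x = cls X t" using X(2) by (rule ob_L_cases)
    have "mp L X X (idn C X) x = cls X (Act X (idn C X) (rep X x))" by (simp add: L_def)
    also have "\<dots> = cls X (rep X x)"
      by (intro cls_eq rel.act_id X rep)
    finally show ?thesis using rep(2)[OF X(2)] by simp
  qed
  show "mp L X Z (cmp C X Y Z G F) x = mp L X Y F (mp L Y Z G x)"
    if X: "X \<in> obj C" "Y \<in> obj C" "Z \<in> obj C" "F \<in> hom C X Y" "G \<in> hom C Y Z" "x \<in> ob L Z"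
    for X Y Z F G x
  proof -
    obtain t where t: "rel Z t t" "x = cls Z t" using X(6) by (rule ob_L_cases)
    have r: "rel Z (rep Z x) (rep Z x)" by (rule rep(1)[OF X(6)])
    have "mp L X Z (cmp C X Y Z G F) x = cls X (Act Z (cmp C X Y Z G F) (rep Z x))"
      by (simp add: L_def)
    also have "\<dots> = cls X (Act Y F (Act Z G (rep Z x)))"
      by (rule cls_eq[OF rel.act_cmp[OF X(1-5) r]])
    also have "\<dots> = mp L X Y F (cls Y (Act Z G (rep Z x)))"
      by (rule mp_L[OF X(1,2,4) rel.act[OF X(2,3,5) r], symmetric])
    also have "cls Y (Act Z G (rep Z x)) = mp L Y Z G x" by (simp add: L_def)
    finally show ?thesis .
  qed
qed

text \<open>Since equality of classes is \<open>rel\<close>, representatives of a matching family,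
  filled up with \<open>Junk\<close>, are a legitimate argument of \<open>Glue\<close>. Then
  \<open>glue_act\<close> gives existence and \<open>separated\<close> uniqueness.\<close>

lemma sheaf_L: "sheaf L"
  unfolding sheaf_iff
proof (intro ballI allI impI)
  fix X R s assume X: "X \<in> obj C" and R: "cov X R" and s: "matching L X R s"
  note RD = cov_obj[OF X R] \<iota>_hom[OF cov_obj[OF X R] X cov_hom[OF X R]]
  define r where "r w = (if w \<in> R then rep (fst w) (s w) else Junk)" for w
  have r: "rel W (r (W, F)) (r (W, F))" "cls W (r (W, F)) = s (W, F)" if "(W, F) \<in> R" for W F
  proof -
    have "s (W, F) \<in> ob L W" using s that unfolding matching_def by blast
    from rep[OF this] show "rel W (r (W, F)) (r (W, F))" "cls W (r (W, F)) = s (W, F)"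
      using that by (simp_all add: r_def)
  qed
  have act: "rel V (Act W (\<iota> V W G) (r (W, F))) (r (V, cmp S V W X F G))"
    if WF: "(W, F) \<in> R" and V: "V \<in> obj C" "G \<in> hom S V W" for W F V G
  proof -
    note W = cov_obj[OF X R WF]
    note G = \<iota>_hom[OF V(1) W V(2)]
    note VFG = cov_cmp[OF X R WF V]
    have "mp L V W (\<iota> V W G) (s (W, F)) = s (V, cmp S V W X F G)"
      using s WF V unfolding matching_def by blast
    then have "cls V (Act W (\<iota> V W G) (r (W, F))) = cls V (r (V, cmp S V W X F G))"
      using mp_L[OF V(1) W G r(1)[OF WF]] by (simp only: r(2)[OF WF] r(2)[OF VFG])
    then show ?thesis
      using cls_eq_iff[OF rel.act[OF V(1) W G r(1)[OF WF]] r(1)[OF VFG]] by simp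
  qed
  have junk: "r w = Junk" if "w \<notin> R" for w using that by (simp add: r_def)
  have g: "rel X (Glue R r) (Glue R r)"
    by (rule rel.glue[OF X R r(1) act]) (simp_all add: junk)
  have ga: "rel W (Act X (\<iota> W X F) (Glue R r)) (r (W, F))" if "(W, F) \<in> R" for W F
    by (rule rel.glue_act[OF X R r(1) act junk that])
  show "\<exists>!x. amalgamation L X R s x"
  proof (rule ex_ex1I)
    have "mp L W X (\<iota> W X F) (cls X (Glue R r)) = s (W, F)" if WF: "(W, F) \<in> R" for W F
      unfolding mp_L[OF RD(1)[OF WF] X RD(2)[OF WF WF] g] cls_eq[OF ga[OF WF]] r(2)[OF WF] ..
    then show "\<exists>x. amalgamation L X R s x"
      using cls_in[OF g] unfolding amalgamation_def by blast
  next
    fix x y assume x: "amalgamation L X R s x" and y: "amalgamation L X R s y"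
    have "x \<in> ob L X" "y \<in> ob L X" using x y by (auto simp: amalgamation_def)
    then obtain t t' where t: "rel X t t" "x = cls X t" and t': "rel X t' t'" "y = cls X t'"
      by (meson ob_L_cases)
    have "rel W (Act X (\<iota> W X F) t) (Act X (\<iota> W X F) t')" if WF: "(W, F) \<in> R" for W F
    proof -
      note h = RD(1)[OF WF] X RD(2)[OF WF WF]
      have "mp L W X (\<iota> W X F) x = mp L W X (\<iota> W X F) y"
        using x y WF unfolding amalgamation_def by fastforce
      then show ?thesis
        unfolding t(2) t'(2) mp_L[OF h t(1)] mp_L[OF h t'(1)]
        using cls_eq_iff[OF rel.act[OF h t(1)] rel.act[OF h t'(1)]] by simp
    qed
    \<comment> \<open>The restrictions of \<open>x\<close> are the values of \<open>s\<close>, so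
      the matching condition on \<open>s\<close> supplies the last premise of
      \<open>separated\<close>.\<close>
    moreover have "rel V (Act W (\<iota> V W G) (Act X (\<iota> W X F) t)) (Act X (\<iota> V X (cmp S V W X F G)) t)"
      if WF: "(W, F) \<in> R" and V: "V \<in> obj C" "G \<in> hom S V W" for W F V G
    proof -
      note W = RD(1)[OF WF]
      note F = RD(2)[OF WF WF]
      note G = \<iota>_hom[OF V(1) W V(2)]
      note VFG = cov_cmp[OF X R WF V]
      note FG = RD(2)[OF VFG VFG]
      have "mp L V W (\<iota> V W G) (s (W, F)) = s (V, cmp S V W X F G)"
        using s WF V unfolding matching_def by blast
      moreover have "s (W, F) = cls W (Act X (\<iota> W X F) t)"
        using x WF mp_L[OF W X F t(1)] unfolding amalgamation_def t(2) by auto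
      moreover have "s (V, cmp S V W X F G) = cls V (Act X (\<iota> V X (cmp S V W X F G)) t)"
        using x VFG mp_L[OF V(1) X FG t(1)] unfolding amalgamation_def t(2) by auto
      moreover have a: "rel W (Act X (\<iota> W X F) t) (Act X (\<iota> W X F) t)"
        by (rule rel.act[OF W X F t(1)])
      ultimately show ?thesis
        using cls_eq_iff[OF rel.act[OF V(1) W G a] rel.act[OF V(1) X FG t(1)]]
          mp_L[OF V(1) W G a] by simp
    qed
    ultimately have "rel X t t'" by (rule rel.separated[OF X R t(1) t'(1)])
    then show "x = y" unfolding t(2) t'(2) by (rule cls_eq)
  qed
qed

definition inj_L :: "'u \<Rightarrow> 'o \<Rightarrow> 'u \<Rightarrow> 'u" where
  "inj_L i = (\<lambda>X\<in>obj C. \<lambda>x\<in>ob (D i) X. cls X (Base (i, x)))"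

lemma inj_L_nat_trans:
  assumes i: "i \<in> obj J"
  shows "inj_L i \<in> nat_trans C (D i) L"
proof (rule nat_transI)
  show "inj_L i X \<in> ob (D i) X \<rightarrow>\<^sub>E ob L X" if "X \<in> obj C" for X
    using that i cls_in[OF rel.base] by (auto simp: inj_L_def)
  show "inj_L i X = undefined" if "X \<notin> obj C" for X
    using that by (simp add: inj_L_def)
  show "inj_L i X (mp (D i) X Y F y) = mp L X Y F (inj_L i Y y)"
    if X: "X \<in> obj C" "Y \<in> obj C" "F \<in> hom C X Y" and y: "y \<in> ob (D i) Y" for X Y F y
    using X y presheaf_mp_in[OF D[OF i] X y] mp_L[OF X rel.base[OF X(2) i y]]
      cls_eq[OF rel.base_act[OF X i y]]
    by (simp add: inj_L_def)
qed

lemma inj_L_diagram: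
  assumes "i \<in> obj J" "j \<in> obj J" "a \<in> hom J i j" "X \<in> obj C" "x \<in> ob (D i) X"
  shows "inj_L j X (DD i j a X x) = inj_L i X x"
  using assms nat_trans_in[OF DD] cls_eq[OF rel.diagram] by (simp add: inj_L_def)

end

section \<open>Universal property of the quotient\<close>

locale sheaf_cocone = small_presheaf_diagram C S \<iota> cov U J D DD
  for C S :: "('o, 'm) cat" and \<iota> cov and U :: "'u set set" and J D DD +
  fixes M :: "('o, 'm, 'u) psh" and \<mu> :: "'u \<Rightarrow> 'o \<Rightarrow> 'u \<Rightarrow> 'u"
  assumes presheaf_M: "is_presheaf U C M" and sheaf_M: "sheaf M"
    and \<mu>: "i \<in> obj J \<Longrightarrow> \<mu> i \<in> nat_trans C (D i) M"
    and \<mu>_diagram: "i \<in> obj J \<Longrightarrow> j \<in> obj J \<Longrightarrow> a \<in> hom J i j \<Longrightarrow> X \<in> obj C \<Longrightarrow> x \<in> ob (D i) X \<Longrightarrow>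
      \<mu> j X (DD i j a X x) = \<mu> i X x"
begin

text \<open>Terms do not record the object over which they live: \<open>Act\<close> stores the
  target of its morphism, and the source is the object of evaluation; a member \<open>w\<close> of a
  sieve is evaluated over its source \<open>fst w\<close>. Ill-formed terms get unspecified
  values.\<close>

definition ev :: "('o, 'm, 'u \<times> 'u) tm \<Rightarrow> 'o \<Rightarrow> 'u" where
  "ev = tm_fold (\<lambda>X. undefined) (\<lambda>(i, x) X. \<mu> i X x) (\<lambda>Y F v X. mp M X Y F (v Y))
     (\<lambda>R v X. THE x. amalgamation M X R (\<lambda>w. v w (fst w)) x)"

lemma ev_simps:
  "ev (Base (i, x)) X = \<mu> i X x" "ev (Act Y F t) X = mp M X Y F (ev t Y)"
  "ev (Glue R s) X = (THE x. amalgamation M X R (\<lambda>w. ev (s w) (fst w)) x)"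
  by (simp_all add: ev_def)

text \<open>Each clause of \<open>rel\<close> holds in \<open>M\<close> after evaluation. Membership
  is proved together with equality, since the amalgamation named in \<open>ev\<close> is meaningful
  only once the family is known to match.\<close>

lemma rel_ev: "rel X t t' \<Longrightarrow> ev t X \<in> ob M X \<and> ev t' X = ev t X"
proof (induction rule: rel.induct)
  case (base X i x)
  then show ?case using nat_trans_in[OF \<mu>] by (simp add: ev_simps)
next
  case (diagram X i j a x)
  then show ?case using nat_trans_in[OF \<mu>] by (simp add: ev_simps \<mu>_diagram)
next
  case (base_act X Y F i x)
  then show ?case
    using nat_trans_in[OF \<mu>] presheaf_mp_in[OF presheaf_M] nat_trans_mp[OF \<mu>]
    by (simp add: ev_simps)
next
  case (act X Y F t t')
  then show ?case using presheaf_mp_in[OF presheaf_M] by (simp add: ev_simps)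
next
  case (act_id X t)
  then show ?case using presheaf_id[OF presheaf_M] by (simp add: ev_simps)
next
  case (act_cmp X Y Z F G t)
  then show ?case
    using presheaf_mp_in[OF presheaf_M] presheaf_cmp[OF presheaf_M] by (simp add: ev_simps)
next
  case (glue X R s s')
  let ?v = "\<lambda>s :: 'o \<times> 'm \<Rightarrow> ('o, 'm, 'u \<times> 'u) tm. \<lambda>w. ev (s w) (fst w)"
  have "matching M X R (?v s)"
    using glue.IH by (fastforce simp: matching_def ev_simps)
  from amalgamation_the[OF sheaf_M glue.hyps(1,2) this]
  have "ev (Glue R s) X \<in> ob M X" by (simp add: ev_simps amalgamation_def)
  moreover have "amalgamation M X R (?v s') = amalgamation M X R (?v s)"
    using glue.IH(1) by (intro amalgamation_cong) simp
  ultimately show ?case by (simp add: ev_simps)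
next
  case (glue_act X R s W F)
  let ?v = "\<lambda>w. ev (s w) (fst w)"
  have "matching M X R ?v"
    using glue_act.IH by (fastforce simp: matching_def ev_simps)
  from amalgamation_the[OF sheaf_M glue_act.hyps(1,2) this]
  have "mp M W X (\<iota> W X F) (ev (Glue R s) X) = ev (s (W, F)) W"
    using glue_act.hyps(6) by (auto simp: ev_simps amalgamation_def)
  then show ?case using glue_act.IH(1)[OF glue_act.hyps(6)] by (simp add: ev_simps)
next
  case (separated X R t t')
  \<comment> \<open>Both values amalgamate the restrictions of \<open>ev t X\<close>; the last
    premise of \<open>separated\<close> evaluates to the matching condition for this family.\<close>
  let ?v = "\<lambda>(W, F). mp M W X (\<iota> W X F) (ev t X)"
  have t: "ev t X \<in> ob M X" "ev t' X \<in> ob M X" using separated.IH(1,2) by auto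
  have "amalgamation M X R ?v (ev t X)" "amalgamation M X R ?v (ev t' X)"
    using t separated.IH(3) by (auto simp: amalgamation_def ev_simps)
  moreover have "matching M X R ?v"
    using separated.IH(3,4) by (fastforce simp: matching_def ev_simps)
  ultimately have "ev t' X = ev t X"
    by (intro amalgamation_unique[OF sheaf_M separated.hyps(1,2)])
  then show ?case using t by simp
qed auto

definition ind :: "'o \<Rightarrow> 'u \<Rightarrow> 'u" where
  "ind = (\<lambda>X\<in>obj C. \<lambda>z\<in>ob L X. ev (rep X z) X)"

lemma ind_cls:
  assumes "rel X t t'"
  shows "ind X (cls X t) = ev t X"
  using rel_obj[OF assms] cls_in[OF assms] rel_ev[OF rep_cls[OF rel_refl(1)[OF assms]]]
  by (simp add: ind_def)

lemma ind_nat_trans: "ind \<in> nat_trans C L M"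
proof (rule nat_transI)
  show "ind X \<in> ob L X \<rightarrow>\<^sub>E ob M X" if "X \<in> obj C" for X
  proof (rule PiE_I)
    show "ind X z \<in> ob M X" if "z \<in> ob L X" for z
      using that by (rule ob_L_cases) (simp add: ind_cls conjunct1[OF rel_ev])
    show "ind X z = undefined" if "z \<notin> ob L X" for z
      using that \<open>X \<in> obj C\<close> by (simp add: ind_def)
  qed
  show "ind X = undefined" if "X \<notin> obj C" for X
    using that by (simp add: ind_def)
  show "ind X (mp L X Y F z) = mp M X Y F (ind Y z)"
    if X: "X \<in> obj C" "Y \<in> obj C" "F \<in> hom C X Y" and z: "z \<in> ob L Y" for X Y F z
  proof -
    obtain t where t: "rel Y t t" "z = cls Y t" using z by (rule ob_L_cases)
    show ?thesis
      unfolding t(2) mp_L[OF X t(1)] ind_cls[OF t(1)] ind_cls[OF rel.act[OF X t(1)]]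
      by (rule ev_simps)
  qed
qed

lemma ind_inj_L:
  assumes "i \<in> obj J" "X \<in> obj C" "x \<in> ob (D i) X"
  shows "ind X (inj_L i X x) = \<mu> i X x"
  using assms ind_cls[OF rel.base] by (simp add: inj_L_def ev_simps)

text \<open>Every element of the quotient is the class of a term. Naturality forces \<open>u\<close>
  on \<open>Act\<close>, and uniqueness of amalgamations in \<open>M\<close> forces it on
  \<open>Glue\<close>.\<close>

lemma ind_unique:
  assumes u: "u \<in> nat_trans C L M"
    and u\<mu>: "\<And>i X x. i \<in> obj J \<Longrightarrow> X \<in> obj C \<Longrightarrow> x \<in> ob (D i) X \<Longrightarrow> u X (inj_L i X x) = \<mu> i X x"
  shows "u = ind"
proof -
  have base_ev: "u X (cls X (Base (i, x))) = ev (Base (i, x)) X"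
    if "i \<in> obj J" "X \<in> obj C" "x \<in> ob (D i) X" for i X x
    using u\<mu>[OF that] that by (simp add: inj_L_def ev_simps)
  have act_ev: "u X (cls X (Act Y F t)) = ev (Act Y F t) X"
    if "X \<in> obj C" "Y \<in> obj C" "F \<in> hom C X Y" "rel Y t t" "u Y (cls Y t) = ev t Y" for X Y F t
    using nat_trans_mp[OF u that(1-3) cls_in[OF that(4)]] mp_L[OF that(1-4)] that(5)
    by (simp add: ev_simps)
  have u_ev: "u X (cls X t) = ev t X" if "rel X t t'" for X t t'
    using that
  proof (induction rule: rel.induct)
    \<comment> \<open>The claim concerns the left term only; it passes to the right one because
      related terms have equal classes and equal values.\<close>
    case (sym X t t')
    then show ?case using cls_eq[OF sym.hyps] rel_ev[OF sym.hyps] by simp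
  next
    case (diagram X i j a x)
    show ?case
      by (intro base_ev diagram nat_trans_in[OF DD[OF diagram(2-4)]])
  next
    case (base_act X Y F i x)
    then show ?case by (intro act_ev rel.base base_ev)
  next
    case (act X Y F t t')
    show ?case by (intro act_ev act.hyps(1-3) rel_refl(1)[OF act.hyps(4)] act.IH)
  next
    case (act_id X t)
    have "cls X (Act X (idn C X) t) = cls X t"
      by (rule cls_eq[OF rel.act_id[OF act_id.hyps]])
    then show ?case
      using act_id.IH rel_ev[OF rel.act_id[OF act_id.hyps]] by simp
  next
    case (act_cmp X Y Z F G t)
    note r = rel.act_cmp[OF act_cmp.hyps]
    have "u X (cls X (Act Y F (Act Z G t))) = ev (Act Y F (Act Z G t)) X"
      using act_cmp by (intro act_ev rel.act)
    then show ?case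
      using cls_eq[OF r] rel_ev[OF r] by simp
  next
    case (glue X R s s')
    have s: "rel W (s (W, F)) (s (W, F))" if "(W, F) \<in> R" for W F
      using glue.hyps(3)[OF that] by (rule rel_refl)
    have junk: "s w = Junk" if "w \<notin> R" for w using glue.hyps(5)[OF that] by (rule conjunct1)
    note g = rel_refl(1)[OF rel.glue[of X R s s', OF glue.hyps]]
    let ?v = "\<lambda>w. ev (s w) (fst w)"
    have m: "matching M X R ?v"
      unfolding matching_def
    proof (clarify, intro conjI ballI)
      fix W F assume WF: "(W, F) \<in> R"
      then show "?v (W, F) \<in> ob M W" using rel_ev[OF s] by simp
      fix V G assume "V \<in> obj C" "G \<in> hom S V W"
      from rel_ev[OF glue.hyps(4)[OF WF this]]
      show "mp M V W (\<iota> V W G) (?v (W, F)) = ?v (V, cmp S V W X F G)"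
        by (simp only: ev_simps fst_conv)
    qed
    \<comment> \<open>By naturality and \<open>glue_act\<close>, the value of \<open>u\<close> at
      the glued class restricts to the members of \<open>?v\<close>, just as the evaluation of the
      glued term does.\<close>
    have "mp M W X (\<iota> W X F) (u X (cls X (Glue R s))) = ev (s (W, F)) W" if WF: "(W, F) \<in> R" for W F
    proof -
      note W = cov_obj[OF glue.hyps(1,2) WF]
      note F = \<iota>_hom[OF W glue.hyps(1) cov_hom[OF glue.hyps(1,2) WF]]
      have "mp M W X (\<iota> W X F) (u X (cls X (Glue R s))) = u W (mp L W X (\<iota> W X F) (cls X (Glue R s)))"
        by (rule nat_trans_mp[OF u W glue.hyps(1) F cls_in[OF g], symmetric])
      also have "\<dots> = u W (cls W (Act X (\<iota> W X F) (Glue R s)))"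
        by (rule arg_cong[OF mp_L[OF W glue.hyps(1) F g]])
      also have "\<dots> = u W (cls W (s (W, F)))"
        by (rule arg_cong[OF cls_eq[OF rel.glue_act[of X R s, OF glue.hyps(1,2) s glue.hyps(4) junk WF]]])
      also have "\<dots> = ev (s (W, F)) W" by (rule glue.IH(1)[OF WF])
      finally show ?thesis .
    qed
    then have "amalgamation M X R ?v (u X (cls X (Glue R s)))"
      using nat_trans_in[OF u glue.hyps(1) cls_in[OF g]] by (auto simp: amalgamation_def)
    moreover have "amalgamation M X R ?v (ev (Glue R s) X)"
      unfolding ev_simps by (rule amalgamation_the[OF sheaf_M glue.hyps(1,2) m])
    ultimately show ?case
      by (rule amalgamation_unique[OF sheaf_M glue.hyps(1,2) m])
  next
    case (glue_act X R s W F)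
    note r = rel.glue_act[of X R s W F, OF glue_act.hyps]
    show ?case
      using cls_eq[OF r] rel_ev[OF r] glue_act.IH(1)[OF glue_act.hyps(6)] by simp
  next
    case (base X i x)
    from base(2,1,3) show ?case by (rule base_ev)
  next
    case (trans X t t' t'')
    show ?case by (rule trans.IH(1))
  next
    case (separated X R t t')
    show ?case by (rule separated.IH(1))
  qed
  show ?thesis
  proof (intro nat_trans_eqI[OF u ind_nat_trans])
    fix X z assume "X \<in> obj C" "z \<in> ob L X"
    from this(2) show "u X z = ind X z"
      by (rule ob_L_cases) (simp add: u_ev ind_cls)
  qed
qed

end

text \<open>Infinitude of \<open>'o \<times> 'm\<close> is an input of the coding of terms, where
  the exponent has to absorb its own square.\<close>

theorem (in restricted_site) cocomplete_sheaves:
  fixes U :: "'u set set"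
  assumes U: "set_universe (UNIV :: ('o \<times> 'o \<times> 'm) set) U"
    and inf: "infinite (UNIV :: ('o \<times> 'm) set)"
  shows "cocomplete U (full_subcategory (presheaf_category U C) sheaf)"
    (is "cocomplete U ?Sh")
  unfolding cocomplete_def
proof (intro allI impI)
  fix J :: "('u, 'u) cat" and D DD
  assume JD: "small_category U J \<and> is_functor J ?Sh D DD"
  have obj: "obj ?Sh = {P. is_presheaf U C P \<and> sheaf P}" and hom: "hom ?Sh = nat_trans C"
    and cmp: "cmp ?Sh = (\<lambda>P Q R \<theta> \<eta>. \<lambda>X\<in>obj C. \<lambda>x\<in>ob P X. \<theta> X (\<eta> X x))"
    by (simp_all add: full_subcategory_def presheaf_category_def)
  interpret small_presheaf_diagram C S \<iota> cov U J D DD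
  proof
    show "is_presheaf U C (D i)" if "i \<in> obj J" for i
      using JD that unfolding is_functor_def obj by blast
    show "DD i j a \<in> nat_trans C (D i) (D j)" if "i \<in> obj J" "j \<in> obj J" "a \<in> hom J i j" for i j a
      using JD that unfolding is_functor_def hom by blast
    show "obj J \<in> U" using JD by (simp add: small_category_def)
  qed (fact U inf)+
  have "is_colimit J ?Sh D DD L inj_L"
    unfolding is_colimit_def
  proof (intro conjI allI impI)
    show "is_cocone J ?Sh D DD L inj_L"
      unfolding is_cocone_def
    proof (intro conjI ballI)
      show "L \<in> obj ?Sh" using presheaf_L sheaf_L by (simp add: obj)
      show "inj_L i \<in> hom ?Sh (D i) L" if "i \<in> obj J" for i
        using inj_L_nat_trans[OF that] by (simp add: hom)
      show "cmp ?Sh (D i) (D j) L (inj_L j) (DD i j a) = inj_L i"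
        if ij: "i \<in> obj J" "j \<in> obj J" "a \<in> hom J i j" for i j a
        unfolding cmp inj_L_def[of i]
        using inj_L_diagram[OF ij] by (intro restrict_ext) (simp add: inj_L_def[of i])
    qed
  next
    fix M \<mu> assume M: "is_cocone J ?Sh D DD M \<mu>"
    interpret sheaf_cocone C S \<iota> cov U J D DD M \<mu>
    proof
      show "is_presheaf U C M" "sheaf M" using M unfolding is_cocone_def obj by blast+
      show "\<mu> i \<in> nat_trans C (D i) M" if "i \<in> obj J" for i
        using M that unfolding is_cocone_def hom by blast
      show "\<mu> j X (DD i j a X x) = \<mu> i X x"
        if ij: "i \<in> obj J" "j \<in> obj J" "a \<in> hom J i j" and x: "X \<in> obj C" "x \<in> ob (D i) X"
        for i j a X x
      proof -
        have eq: "cmp ?Sh (D i) (D j) M (\<mu> j) (DD i j a) = \<mu> i"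
          using M ij unfolding is_cocone_def by blast
        show ?thesis
          using fun_cong[OF fun_cong[OF eq, of X], of x] x by (simp add: cmp)
      qed
    qed
    show "\<exists>!u. u \<in> hom ?Sh L M \<and> (\<forall>i\<in>obj J. cmp ?Sh (D i) L M u (inj_L i) = \<mu> i)"
    proof (rule ex1I[of _ ind], intro conjI ballI)
      show "ind \<in> hom ?Sh L M" using ind_nat_trans by (simp add: hom)
      fix i assume i: "i \<in> obj J"
      show "cmp ?Sh (D i) L M ind (inj_L i) = \<mu> i"
      proof (rule nat_trans_eqI[OF _ \<mu>[OF i]])
        show "cmp ?Sh (D i) L M ind (inj_L i) X x = \<mu> i X x" if "X \<in> obj C" "x \<in> ob (D i) X" for X x
          using that ind_inj_L[OF i that] by (simp add: cmp)
        \<comment> \<open>The composite agrees pointwise with \<open>\<mu> i\<close>, so its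
          naturality is read off from that of \<open>\<mu> i\<close>.\<close>
        show "cmp ?Sh (D i) L M ind (inj_L i) \<in> nat_trans C (D i) M"
          unfolding cmp
        proof (rule nat_transI)
          fix X assume X: "X \<in> obj C"
          show "(\<lambda>X\<in>obj C. \<lambda>x\<in>ob (D i) X. ind X (inj_L i X x)) X \<in> ob (D i) X \<rightarrow>\<^sub>E ob M X"
            using X ind_inj_L[OF i X] nat_trans_in[OF \<mu>[OF i] X] by auto
        next
          fix X Y F y assume X: "X \<in> obj C" "Y \<in> obj C" "F \<in> hom C X Y" and y: "y \<in> ob (D i) Y"
          then show "(\<lambda>X\<in>obj C. \<lambda>x\<in>ob (D i) X. ind X (inj_L i X x)) X (mp (D i) X Y F y) =
              mp M X Y F ((\<lambda>X\<in>obj C. \<lambda>x\<in>ob (D i) X. ind X (inj_L i X x)) Y y)"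
            using ind_inj_L[OF i] presheaf_mp_in[OF D[OF i] X y] nat_trans_mp[OF \<mu>[OF i] X y]
            by simp
        qed simp
      qed
    next
      fix u assume u: "u \<in> hom ?Sh L M \<and> (\<forall>i\<in>obj J. cmp ?Sh (D i) L M u (inj_L i) = \<mu> i)"
      show "u = ind"
      proof (rule ind_unique)
        show "u \<in> nat_trans C L M" using u by (simp add: hom)
        show "u X (inj_L i X x) = \<mu> i X x" if "i \<in> obj J" "X \<in> obj C" "x \<in> ob (D i) X" for i X x
        proof -
          have eq: "cmp ?Sh (D i) L M u (inj_L i) = \<mu> i" using u that(1) by blast
          show ?thesis
            using fun_cong[OF fun_cong[OF eq, of X], of x] that by (simp add: cmp)
        qed
      qed
    qed
  qed
  then show "\<exists>L lam. is_colimit J ?Sh D DD L lam" by blast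
qed

section \<open>Whitney categories\<close>

text \<open>A stratified space is a subdivision of itself.\<close>

lemma stratified_imp_prestratified:
  "stratified_space X \<Longrightarrow> stratified X Y f \<Longrightarrow> prestratified X Y f"
  by (auto simp: prestratified_def subdivision_def)

text \<open>The class of maps enters \<open>homotopic_rel\<close> only as a positive condition on
  the maps \<open>h t\<close>, so the same homotopy serves for the larger class.\<close>

lemma homotopy_mono:
  assumes "\<And>f. K X Y f \<Longrightarrow> K' X Y f"
  shows "homotopy n K X Y \<subseteq> homotopy n K' X Y"
proof -
  have "homotopic_rel n K' X Y f g" if "homotopic_rel n K X Y f g" for f g
    using that unfolding homotopic_rel_def
    by (rule ex_forward, elim conj_forward) (assumption | (rule ballI, rule assms, erule bspec))+
  then show ?thesis unfolding homotopy_def by (intro rtrancl_mono) auto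
qed

text \<open>A class of the finer relation, saturated under the coarser one, is the coarser class of
  its representative, by transitivity.\<close>

lemma homotopy_class_prestratified:
  assumes X: "stratified_space X" and F: "F \<in> hom (Strat n) X Y"
  shows "homotopy n prestratified X Y `` F \<in> hom (Prestrat n) X Y"
proof -
  obtain f where f: "stratified X Y f" and F: "F = homotopy n stratified X Y `` {f}"
    using F by (auto simp: Strat_def map_category_def elim: quotientE)
  have "homotopy n stratified X Y \<subseteq> homotopy n prestratified X Y"
    by (rule homotopy_mono) (rule stratified_imp_prestratified[OF X])
  moreover have "trans (homotopy n prestratified X Y)" "(f, f) \<in> homotopy n stratified X Y"
    by (simp_all add: homotopy_def trans_rtrancl)
  ultimately have "homotopy n prestratified X Y `` F = homotopy n prestratified X Y `` {f}"
    unfolding F by (blast dest: transD)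
  then show ?thesis
    using stratified_imp_prestratified[OF X f]
    by (simp add: Prestrat_def map_category_def quotientI)
qed

theorem corollary3p5:
  fixes n :: enat and U :: "'u set set"
  assumes "set_universe (UNIV :: (strat \<times> strat \<times> smap set) set) U"
  shows "cocomplete U (nWhit n U)"
proof -
  interpret restricted_site "Prestrat n" "Strat n" "\<lambda>X Y F. homotopy n prestratified X Y `` F"
    "covering_sieve n"
  proof
    show "obj (Strat n) = obj (Prestrat n)"
      by (simp add: Strat_def Prestrat_def map_category_def)
    then have obj: "obj (Prestrat n) = obj (Strat n)" ..
    show "homotopy n prestratified X Y `` F \<in> hom (Prestrat n) X Y"
      if "X \<in> obj (Prestrat n)" "F \<in> hom (Strat n) X Y" for X Y F
      using that by (intro homotopy_class_prestratified)
        (simp_all add: Prestrat_def map_category_def cell_space_def)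
    fix X R W F assume "covering_sieve n X R" and WF: "(W, F) \<in> R"
    then have R: "is_sieve (Strat n) X R" by (simp add: covering_sieve_def)
    show "W \<in> obj (Prestrat n)" "F \<in> hom (Strat n) W X"
      using R WF unfolding is_sieve_def obj by blast+
    show "(V, cmp (Strat n) V W X F G) \<in> R"
      if "V \<in> obj (Prestrat n)" "G \<in> hom (Strat n) V W" for V G
      using R WF that unfolding is_sieve_def obj by blast
  qed
  \<comment> \<open>Only the type has to be infinite, so singletons of constant maps suffice, one
    for each real number; they need not be morphisms.\<close>
  have "inj (\<lambda>c :: real. ({} :: strat, {\<lambda>_ _. c} :: smap set))"
    by (auto simp: inj_on_def fun_eq_iff)
  then have "infinite (UNIV :: (strat \<times> smap set) set)"
    using finite_imageD infinite_UNIV_char_0 by (metis finite_subset subset_UNIV)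
  from cocomplete_sheaves[OF assms this] show ?thesis
    unfolding nWhit_def restrict_to_Strat_def sheaf_def .
qed

end
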